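(* There is an algorithm which, given a tree $T$ with no vertex of degree $2$, determines $\chi'_{CF}(T)$ (in particular decides whether $\chi'_{CF}(T)=2$ or $\chi'_{CF}(T)=3$) in time $O(|V(T)|)$.
   Context: For a graph $G$ and vertex $v$, $E(v)$ is the set of edges incident with $v$, and for an edge $e=uv$, $E(e)=E(u)\cup E(v)$. A color is a conflict-free color of $e$ in an edge-coloring if it is assigned to exactly one edge of $E(e)$. The conflict-free chromatic index $\chi'_{CF}(G)$ is the least $k$ such that $G$ has an edge-coloring with $k$ colors in which every edge has a conflict-free color. (It is known that $\chi'_{CF}(T)\le 3$ for every tree, and $\chi'_{CF}(T)\ge 2$ when $T$ has at least two edges.) *)

theory Defs
  imports Complex_Main "HOL-Library.Landau_Symbols"
begin

section \<open>Trees\<close>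

text \<open>
  An undirected simple graph is a vertex set \<open>V\<close> with a set \<open>E\<close> of two-element subsets
  of \<open>V\<close>.
\<close>

definition simple_graph :: "'a set \<Rightarrow> 'a set set \<Rightarrow> bool" where
  "simple_graph V E \<longleftrightarrow> finite V \<and> (\<forall>e\<in>E. e \<subseteq> V \<and> card e = 2)"

definition graph_connected :: "'a set \<Rightarrow> 'a set set \<Rightarrow> bool" where
  "graph_connected V E \<longleftrightarrow> V \<noteq> {} \<and> (\<forall>u\<in>V. \<forall>v\<in>V. (u, v) \<in> {(x, y). {x, y} \<in> E}\<^sup>*)"

definition graph_cycle :: "'a set set \<Rightarrow> 'a list \<Rightarrow> bool" where
  "graph_cycle E xs \<longleftrightarrow> length xs \<ge> 3 \<and> distinct xs \<and>
     (\<forall>i<length xs. {xs ! i, xs ! ((i + 1) mod length xs)} \<in> E)"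

definition is_tree :: "'a set \<Rightarrow> 'a set set \<Rightarrow> bool" where
  "is_tree V E \<longleftrightarrow> simple_graph V E \<and> graph_connected V E \<and> (\<nexists>xs. graph_cycle E xs)"

section \<open>Conflict-free edge-colorings\<close>

definition vertex_edges :: "'a set set \<Rightarrow> 'a \<Rightarrow> 'a set set" where
  "vertex_edges E v = {e \<in> E. v \<in> e}"

definition vertex_degree :: "'a set set \<Rightarrow> 'a \<Rightarrow> nat" where
  "vertex_degree E v = card (vertex_edges E v)"

text \<open>The edge \<open>e\<close> belongs to its own neighbourhood \<open>E(e) = E(u) \<union> E(v)\<close>.\<close>

definition edge_neighbourhood :: "'a set set \<Rightarrow> 'a set \<Rightarrow> 'a set set" where
  "edge_neighbourhood E e = (\<Union>v\<in>e. vertex_edges E v)"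

definition conflict_free_color :: "'a set set \<Rightarrow> ('a set \<Rightarrow> nat) \<Rightarrow> 'a set \<Rightarrow> nat \<Rightarrow> bool" where
  "conflict_free_color E f e c \<longleftrightarrow> (\<exists>!e'. e' \<in> edge_neighbourhood E e \<and> f e' = c)"

text \<open>The colors are \<open>0, \<dots>, k - 1\<close>; not all of them need to occur.\<close>

definition conflict_free_coloring :: "'a set set \<Rightarrow> nat \<Rightarrow> ('a set \<Rightarrow> nat) \<Rightarrow> bool" where
  "conflict_free_coloring E k f \<longleftrightarrow>
     (\<forall>e\<in>E. f e < k) \<and> (\<forall>e\<in>E. \<exists>c. conflict_free_color E f e c)"

definition cf_chromatic_index :: "'a set set \<Rightarrow> nat" where
  "cf_chromatic_index E = (LEAST k. \<exists>f. conflict_free_coloring E k f)"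

text \<open>The minimum above is taken over a nonempty set.\<close>

lemma conflict_free_coloring_exists:
  assumes "simple_graph V E"
  shows "\<exists>k f. conflict_free_coloring E k f"
proof -
  have "E \<subseteq> Pow V"
    using assms by (auto simp: simple_graph_def)
  then have "finite E"
    using assms by (meson simple_graph_def finite_Pow_iff finite_subset)
  then obtain f :: "'a set \<Rightarrow> nat" and k where f: "f ` E = {i. i < k}" "inj_on f E"
    using finite_imp_inj_to_nat_seg by metis
  have "conflict_free_color E f e (f e)" if e: "e \<in> E" for e
  proof -
    have "card e = 2"
      using e assms by (auto simp: simple_graph_def)
    then have "e \<noteq> {}"
      by auto
    then show ?thesis
      unfolding conflict_free_color_def
      using e f(2) by (intro ex1I[of _ e])
        (auto simp: edge_neighbourhood_def vertex_edges_def inj_on_def)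
  qed
  then have "conflict_free_coloring E k f"
    using f(1) by (auto simp: conflict_free_coloring_def)
  then show ?thesis
    by blast
qed

section \<open>Random access machines\<close>

text \<open>
  The model of computation is the unit-cost random access machine with a fixed word length.
  Programs are structured: a fixed program uses finitely many registers, sequencing,
  conditionals and loops, and addresses a memory indirectly.  Translating such programs to RAM
  code with jumps, or back, changes running times by a constant factor only.  There is no
  multiplication, and subtraction is truncated at zero.
\<close>

datatype operand = Const nat | Reg nat

datatype test = Less operand operand | Equal operand operand

datatype program =
    Skip
  | Move nat operand
  | Add nat operand operand
  | Sub nat operand operand
  | Load nat operand
  | Store operand operand
  | Seq program program
  | IfElse test program program
  | While test program

type_synonym registers = "nat \<Rightarrow> nat"
type_synonym memory = "nat \<Rightarrow> nat"
type_synonym machine_state = "registers \<times> memory"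

fun operand_val :: "registers \<Rightarrow> operand \<Rightarrow> nat" where
  "operand_val R (Const k) = k"
| "operand_val R (Reg r) = R r"

fun test_val :: "registers \<Rightarrow> test \<Rightarrow> bool" where
  "test_val R (Less a b) \<longleftrightarrow> operand_val R a < operand_val R b"
| "test_val R (Equal a b) \<longleftrightarrow> operand_val R a = operand_val R b"

text \<open>
  \<open>exec W P s t s'\<close>: started in state \<open>s\<close>, the program \<open>P\<close> halts in state \<open>s'\<close> after \<open>t\<close>
  steps, where every word written and every address used is smaller than \<open>W\<close>.  A computation
  that violates the bound \<open>W\<close> is stuck, that is, it has no final state.  The bound keeps the
  unit-cost measure honest: no large numbers can be manipulated in a single step.
  For graphs with \<open>n\<close> vertices we take \<open>W = (n + 1) ^ d\<close> with \<open>d\<close> constant, i.e. words of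
  \<open>O(log n)\<close> bits.
\<close>

inductive exec :: "nat \<Rightarrow> program \<Rightarrow> machine_state \<Rightarrow> nat \<Rightarrow> machine_state \<Rightarrow> bool"
  for W :: nat where
  exec_Skip:
    "exec W Skip s 1 s"
| exec_Move:
    "\<lbrakk> x = operand_val R a; x < W \<rbrakk>
     \<Longrightarrow> exec W (Move r a) (R, M) 1 (R(r := x), M)"
| exec_Add:
    "\<lbrakk> x = operand_val R a + operand_val R b; x < W \<rbrakk>
     \<Longrightarrow> exec W (Add r a b) (R, M) 1 (R(r := x), M)"
| exec_Sub:
    "\<lbrakk> x = operand_val R a - operand_val R b; x < W \<rbrakk>
     \<Longrightarrow> exec W (Sub r a b) (R, M) 1 (R(r := x), M)"
| exec_Load:
    "\<lbrakk> p = operand_val R a; p < W; x = M p; x < W \<rbrakk>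
     \<Longrightarrow> exec W (Load r a) (R, M) 1 (R(r := x), M)"
| exec_Store:
    "\<lbrakk> p = operand_val R a; p < W; x = operand_val R b; x < W \<rbrakk>
     \<Longrightarrow> exec W (Store a b) (R, M) 1 (R, M(p := x))"
| exec_Seq:
    "\<lbrakk> exec W P s t s'; exec W Q s' u s'' \<rbrakk>
     \<Longrightarrow> exec W (Seq P Q) s (t + u) s''"
| exec_IfTrue:
    "\<lbrakk> test_val (fst s) b; exec W P s t s' \<rbrakk>
     \<Longrightarrow> exec W (IfElse b P Q) s (1 + t) s'"
| exec_IfFalse:
    "\<lbrakk> \<not> test_val (fst s) b; exec W Q s t s' \<rbrakk>
     \<Longrightarrow> exec W (IfElse b P Q) s (1 + t) s'"
| exec_WhileFalse:
    "\<not> test_val (fst s) b \<Longrightarrow> exec W (While b P) s 1 s"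
| exec_WhileTrue:
    "\<lbrakk> test_val (fst s) b; exec W P s t s'; exec W (While b P) s' u s'' \<rbrakk>
     \<Longrightarrow> exec W (While b P) s (1 + t + u) s''"

text \<open>Final state and running time are unique, so \<open>exec\<close> describes the run of the program.\<close>

lemma exec_deterministic:
  assumes "exec W P s t s'" and "exec W P s u s''"
  shows "t = u \<and> s' = s''"
  using assms
proof (induction arbitrary: u s'' rule: exec.induct)
  case (exec_Seq P s t s' Q v s'')
  from exec_Seq.prems show ?case
    by (rule exec.cases) (use exec_Seq.IH in fastforce)+
next
  case (exec_IfTrue s b P t s' Q)
  from exec_IfTrue.prems show ?case
    by (rule exec.cases) (use exec_IfTrue.IH exec_IfTrue.hyps in fastforce)+
next
  case (exec_IfFalse s b Q t s' P)
  from exec_IfFalse.prems show ?case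
    by (rule exec.cases) (use exec_IfFalse.IH exec_IfFalse.hyps in fastforce)+
next
  case (exec_WhileTrue s b P t s' v s'')
  from exec_WhileTrue.prems show ?case
    by (rule exec.cases) (use exec_WhileTrue.IH exec_WhileTrue.hyps in fastforce)+
qed (auto elim: exec.cases)

section \<open>Input and output\<close>

text \<open>
  A graph on the vertices \<open>0, \<dots>, n - 1\<close> is presented by a list of its edges, in any order and
  with the two ends of each edge in any order.  The memory initially holds \<open>n\<close>, the number of
  edges and then the ends of the listed edges; all other memory cells and all registers are
  zero.  The answer is left in register \<open>0\<close>.
\<close>

definition edge_list :: "'a set set \<Rightarrow> ('a \<times> 'a) list \<Rightarrow> bool" where
  "edge_list E es \<longleftrightarrow> distinct (map (\<lambda>(u, v). {u, v}) es) \<and> (\<lambda>(u, v). {u, v}) ` set es = E"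

definition input_words :: "nat \<Rightarrow> (nat \<times> nat) list \<Rightarrow> nat list" where
  "input_words n es = n # length es # concat (map (\<lambda>(u, v). [u, v]) es)"

definition initial_state :: "nat list \<Rightarrow> machine_state" where
  "initial_state ws = ((\<lambda>r. 0), (\<lambda>p. if p < length ws then ws ! p else 0))"

definition outputs_within :: "nat \<Rightarrow> program \<Rightarrow> nat list \<Rightarrow> nat \<Rightarrow> nat \<Rightarrow> bool" where
  "outputs_within W P ws T y \<longleftrightarrow>
     (\<exists>t s. exec W P (initial_state ws) t s \<and> t \<le> T \<and> fst s 0 = y)"

end

theory Submission
  imports Defs
begin

text \<open>
  If two colors suffice and no vertex has degree 2, then two edges sharing a vertex of degree at
  least 3 cannot have different conflict-free colors only, as each color would occur at most once
  there.  By connectivity one color is conflict-free for all edges, and its color class is an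
  induced matching that meets every edge.  Whether such a matching exists is decided by cutting
  off leaves one at a time and recording, at the neighbour of the leaf, which states of the
  neighbour are compatible with the part cut off.  Three colors always suffice, by coloring a
  rooted tree in layers.  A linear-time program finds the leaves by one scan over the vertices:
  whenever cutting off a leaf turns its neighbour into a leaf, it continues with the neighbour.
\<close>

section \<open>Trees and their leaves\<close>

text \<open>A part that has been cut off touches the rest of the tree in a single vertex, so all it
  can pass on is which of three situations of that vertex it permits: uncovered, still to be
  matched, already matched. Hence constant memory per vertex and constant work per cut. Solvability
  is stated for arbitrary sets of permitted states at the vertices, since the statement has to
  survive the cutting of leaves. The scan is linear although it follows chains of new leaves and
  then returns to its counter: every pass removes a vertex or advances the counter, so the number of
  remaining vertices plus the distance of the counter from \<open>n\<close> drops by one. No leaf is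
  missed, because a cut lowers the degree of only one remaining vertex, the one where the scan
  continues.\<close>

definition nbrs :: "'a set set \<Rightarrow> 'a \<Rightarrow> 'a set" where
  "nbrs E v = {w. {v, w} \<in> E}"

lemma simple_graph_edgeD:
  assumes "simple_graph V E" "{x, y} \<in> E"
  shows "x \<noteq> y" "x \<in> V" "y \<in> V"
proof -
  have "{x, y} \<subseteq> V" "card {x, y} = 2"
    using assms unfolding simple_graph_def by blast+
  then show "x \<noteq> y" "x \<in> V" "y \<in> V"
    by auto
qed

lemma simple_graph_edgeE:
  assumes "simple_graph V E" "e \<in> E"
  obtains x y where "e = {x, y}" "x \<noteq> y" "x \<in> V" "y \<in> V"
proof -
  have "e \<subseteq> V" "card e = 2"
    using assms unfolding simple_graph_def by blast+
  then show thesis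
    using that by (auto simp: card_2_iff)
qed

lemma nbrs_subset: "simple_graph V E \<Longrightarrow> nbrs E v \<subseteq> V"
  unfolding nbrs_def using simple_graph_edgeD by fast

lemma is_treeD:
  assumes "is_tree V E"
  shows "simple_graph V E" "finite V" "V \<noteq> {}"
  using assms by (auto simp: is_tree_def simple_graph_def graph_connected_def)

lemma tree_has_nbr:
  assumes "is_tree V E" "x \<in> V" "card V \<ge> 2"
  shows "\<exists>w. {x, w} \<in> E"
proof -
  have "\<not> V \<subseteq> {x}"
    using assms(3) card_mono[of "{x}" V] by auto
  then obtain u where u: "u \<in> V" "u \<noteq> x"
    by blast
  then have "(x, u) \<in> {(x, y). {x, y} \<in> E}\<^sup>*"
    using assms(1,2) by (auto simp: is_tree_def graph_connected_def)
  then show ?thesis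
    using u(2) by (auto elim: converse_rtranclE)
qed

text \<open>Take a longest path. If its first vertex has a neighbour besides its successor, that
  neighbour either prolongs the path or lies on it and closes a cycle.\<close>

lemma tree_has_leaf:
  assumes T: "is_tree V E" and c: "card V \<ge> 2"
  shows "\<exists>v\<in>V. \<exists>p. nbrs E v = {p}"
proof (rule ccontr)
  assume no: "\<not> ?thesis"
  note sg = is_treeD(1)[OF T] and fin = is_treeD(2)[OF T]
  define P where "P xs \<longleftrightarrow> xs \<noteq> [] \<and> distinct xs \<and> set xs \<subseteq> V \<and>
    (\<forall>i. Suc i < length xs \<longrightarrow> {xs ! i, xs ! Suc i} \<in> E)" for xs
  obtain v0 where "v0 \<in> V"
    using is_treeD(3)[OF T] by blast
  then have "P [v0]"
    by (simp add: P_def)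
  moreover have "\<forall>xs. P xs \<longrightarrow> length xs \<le> card V"
    using fin by (metis P_def card_mono distinct_card)
  ultimately obtain xs where xs: "P xs" and mx: "\<And>ys. P ys \<Longrightarrow> length ys \<le> length xs"
    using ex_has_greatest_nat[of P "[v0]" length "Suc (card V)"] by (auto simp: less_Suc_eq_le)
  obtain x zs where xz: "xs = x # zs"
    using xs by (cases xs) (auto simp: P_def)
  have xV: "x \<in> V"
    using xs xz by (simp add: P_def)
  obtain w where w: "{x, w} \<in> E"
    using tree_has_nbr[OF T xV c] by blast
  have "\<exists>y. {x, y} \<in> E \<and> (zs \<noteq> [] \<longrightarrow> y \<noteq> zs ! 0)"
  proof (cases "zs = []")
    case False
    have "nbrs E x \<noteq> {zs ! 0}"
      using no xV by blast
    moreover have "{xs ! 0, xs ! Suc 0} \<in> E"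
      using xs xz False unfolding P_def by (cases zs) auto
    ultimately show ?thesis
      using xz by (auto simp: nbrs_def)
  qed (use w in auto)
  then obtain y where y: "{x, y} \<in> E" "zs \<noteq> [] \<Longrightarrow> y \<noteq> zs ! 0"
    by blast
  note yx = simple_graph_edgeD[OF sg y(1)]
  show False
  proof (cases "y \<in> set xs")
    case False
    have "P (y # xs)"
      unfolding P_def
    proof (intro conjI allI impI)
      fix i assume "Suc i < length (y # xs)"
      then show "{(y # xs) ! i, (y # xs) ! Suc i} \<in> E"
        using xs y(1) xz by (cases i) (auto simp: P_def insert_commute)
    qed (use False xs yx in \<open>auto simp: P_def\<close>)
    from mx[OF this] show False
      by simp
  next
    case True
    then obtain j where j: "j < length xs" "xs ! j = y"
      by (auto simp: in_set_conv_nth)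
    \<comment> \<open>Index 0 is \<open>x\<close> itself and index 1 its successor; \<open>y\<close>
      differs from both. This makes the closed walk at least 3 long, as \<open>graph_cycle\<close>
      demands.\<close>
    have j2: "j \<ge> 2"
    proof (rule ccontr)
      assume "\<not> j \<ge> 2"
      then consider "j = 0" | "j = 1"
        by linarith
      then show False
        using j y(2) yx(1) xz by cases auto
    qed
    define ys where "ys = take (Suc j) xs"
    have len: "length ys = Suc j"
      using j by (simp add: ys_def)
    have "graph_cycle E ys"
      unfolding graph_cycle_def
    proof (intro conjI allI impI)
      show "distinct ys"
        using xs by (simp add: ys_def P_def)
      fix i assume i: "i < length ys"
      show "{ys ! i, ys ! ((i + 1) mod length ys)} \<in> E"
      proof (cases "i = j")
        case True
        moreover have "ys ! j = y"
          using j by (simp add: ys_def)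
        moreover have "ys ! 0 = x"
          using xz by (simp add: ys_def)
        ultimately show ?thesis
          using y(1) len by (simp add: insert_commute)
      next
        case False
        then have "i < j"
          using i len by simp
        then show ?thesis
          using xs j len by (simp add: ys_def P_def)
      qed
    qed (use len j2 in simp)
    then show False
      using T by (auto simp: is_tree_def)
  qed
qed

lemma tree_remove_leaf:
  assumes T: "is_tree V E" and v: "v \<in> V" "nbrs E v = {p}"
  shows "is_tree (V - {v}) (E - {{v, p}})" "p \<in> V - {v}" "{v, p} \<in> E"
proof -
  note sg = is_treeD(1)[OF T]
  show vp: "{v, p} \<in> E"
    using v by (auto simp: nbrs_def)
  show pV: "p \<in> V - {v}"
    using simple_graph_edgeD[OF sg vp] by auto
  let ?E = "E - {{v, p}}"
  \<comment> \<open>Folding the leaf onto its neighbour turns each step of a walk into a step of the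
    remainder or a standstill, which gives connectivity.\<close>
  define h where "h x = (if x = v then p else x)" for x
  have nv: "v \<notin> e" if e: "e \<in> ?E" for e
  proof
    assume "v \<in> e"
    then obtain w where "e = {v, w}"
      using simple_graph_edgeE[OF sg, of e] e by (metis DiffD1 insert_commute insertE singletonD)
    then show False
      using e v(2) by (auto simp: nbrs_def)
  qed
  have "(h x, h y) \<in> {(x, y). {x, y} \<in> ?E}\<^sup>*" if "(x, y) \<in> {(x, y). {x, y} \<in> E}\<^sup>*" for x y
    using that
  proof (induction rule: rtrancl_induct)
    case (step y z)
    have "h y = h z \<or> {h y, h z} \<in> ?E"
      using step(2) v(2) by (auto simp: h_def nbrs_def doubleton_eq_iff insert_commute)
    then have "h y = h z \<or> (h y, h z) \<in> {(x, y). {x, y} \<in> ?E}"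
      by simp
    then show ?case
      using step(3) by (elim disjE) (simp, rule rtrancl_into_rtrancl)
  qed simp
  then have "(x, y) \<in> {(x, y). {x, y} \<in> ?E}\<^sup>*" if "x \<in> V - {v}" "y \<in> V - {v}" for x y
    using that T by (fastforce simp: h_def is_tree_def graph_connected_def)
  then have "graph_connected (V - {v}) ?E"
    using pV by (auto simp: graph_connected_def)
  moreover have "simple_graph (V - {v}) ?E"
    using sg nv by (auto simp: simple_graph_def)
  moreover have "\<not> graph_cycle ?E xs" for xs
    using T by (auto simp: is_tree_def graph_cycle_def)
  ultimately show "is_tree (V - {v}) ?E"
    by (simp add: is_tree_def)
qed

lemma tree_singleton:
  assumes "is_tree {v} E"
  shows "E = {}"
  using simple_graph_edgeE[OF is_treeD(1)[OF assms]] by blast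

text \<open>Leaf removal read backwards, for constructions that attach one new vertex
  \<open>v\<close> to an existing \<open>p\<close>.\<close>

lemma tree_induct [consumes 1, case_names single leaf]:
  assumes "is_tree V E"
    and single: "\<And>v. P {v} {}"
    and leaf: "\<And>V E v p. \<lbrakk> is_tree V E; p \<in> V; v \<notin> V; P V E \<rbrakk> \<Longrightarrow> P (insert v V) (insert {v, p} E)"
  shows "P V E"
  using assms(1)
proof (induction "card V" arbitrary: V E rule: less_induct)
  case less
  note fin = is_treeD(2)[OF less(2)]
  show ?case
  proof (cases "card V \<ge> 2")
    case True
    then obtain v p where v: "v \<in> V" "nbrs E v = {p}"
      using tree_has_leaf[OF less(2)] by blast
    note r = tree_remove_leaf[OF less(2) v]
    have "P (V - {v}) (E - {{v, p}})"
      using less(1)[OF _ r(1)] v(1) fin by (meson card_Diff1_less)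
    from leaf[OF r(1,2) _ this, of v] show ?thesis
      using v(1) r(3) by (simp add: insert_absorb)
  next
    case False
    then have "card V = 1"
      using is_treeD[OF less(2)] by (metis One_nat_def card_gt_0_iff less_2_cases linorder_not_less not_gr0)
    then obtain v where "V = {v}"
      by (auto simp: card_1_singleton_iff)
    then show ?thesis
      using single[of v] tree_singleton[of v E] less(2) by simp
  qed
qed

lemma tree_edges_finite:
  assumes "is_tree V E"
  shows "finite E"
  using is_treeD(1,2)[OF assms] by (meson simple_graph_def finite_Pow_iff finite_subset PowI subsetI)

lemma tree_card_edges:
  assumes "is_tree V E"
  shows "card V = Suc (card E)"
  using assms
proof (induction rule: tree_induct)
  case (leaf V E v p)
  have "{v, p} \<notin> E"
    using leaf simple_graph_edgeD[OF is_treeD(1)[OF leaf(1)]] by blast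
  then show ?case
    using leaf tree_edges_finite[OF leaf(1)] is_treeD[OF leaf(1)] by simp
qed simp

section \<open>Conflict-free colorings of trees\<close>

lemma in_edge_neighbourhood_iff:
  "e' \<in> edge_neighbourhood E e \<longleftrightarrow> e' \<in> E \<and> (\<exists>x. x \<in> e \<and> x \<in> e')"
  by (auto simp: edge_neighbourhood_def vertex_edges_def)

lemma conflict_free_color_unique:
  assumes "conflict_free_color E f e c" "e1 \<in> E" "e2 \<in> E" "x \<in> e" "x \<in> e1" "y \<in> e" "y \<in> e2"
    "f e1 = c" "f e2 = c"
  shows "e1 = e2"
  using assms unfolding conflict_free_color_def in_edge_neighbourhood_iff by blast

lemma two_coloring_common_color:
  assumes T: "is_tree V E" and deg: "\<forall>v\<in>V. vertex_degree E v \<noteq> 2"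
    and f: "conflict_free_coloring E 2 f"
  shows "\<exists>c. \<forall>e\<in>E. conflict_free_color E f e c"
proof (cases "E = {}")
  case False
  note sg = is_treeD(1)[OF T]
  then obtain e0 where e0: "e0 \<in> E"
    using False by blast
  then obtain c where c: "conflict_free_color E f e0 c"
    using f by (auto simp: conflict_free_coloring_def)
  have adj: "conflict_free_color E f e' c"
    if e: "e \<in> E" "e' \<in> E" "v \<in> e" "v \<in> e'" "conflict_free_color E f e c" for e e' v
  proof (rule ccontr)
    assume neg: "\<not> ?thesis"
    obtain c' where c': "conflict_free_color E f e' c'"
      using f e(2) by (auto simp: conflict_free_coloring_def)
    have "c' \<noteq> c"
      using c' neg by blast
    obtain a where a: "a \<in> E" "f a = c" and
      au: "\<And>b. b \<in> edge_neighbourhood E e \<Longrightarrow> f b = c \<Longrightarrow> b = a"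
      using e(5) unfolding conflict_free_color_def in_edge_neighbourhood_iff by blast
    obtain a' where a': "a' \<in> E" "f a' = c'" and
      au': "\<And>b. b \<in> edge_neighbourhood E e' \<Longrightarrow> f b = c' \<Longrightarrow> b = a'"
      using c' unfolding conflict_free_color_def in_edge_neighbourhood_iff by blast
    have lt: "f b < 2" if "b \<in> E" for b
      using f that by (auto simp: conflict_free_coloring_def)
    have "c < 2" "c' < 2"
      using lt a a' by auto
    then have cc: "f b = c \<or> f b = c'" if "b \<in> E" for b
      using lt[OF that] \<open>c' \<noteq> c\<close> by linarith
    \<comment> \<open>Every edge at \<open>v\<close> lies in both neighbourhoods and has color
      \<open>c\<close> or \<open>c'\<close>, so it is the only edge of its color there. As
      \<open>e\<close> and \<open>e'\<close> are already two edges at \<open>v\<close>, the degree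
      would be exactly 2.\<close>
    have sub: "vertex_edges E v \<subseteq> {a, a'}"
    proof
      fix b assume "b \<in> vertex_edges E v"
      then have "b \<in> E" "v \<in> b"
        by (auto simp: vertex_edges_def)
      then have "b \<in> edge_neighbourhood E e" "b \<in> edge_neighbourhood E e'"
        using e(3,4) by (auto simp: in_edge_neighbourhood_iff)
      then show "b \<in> {a, a'}"
        using au au' cc[OF \<open>b \<in> E\<close>] by auto
    qed
    have "v \<in> V"
      using e(1,3) sg by (auto simp: simple_graph_def)
    then have "card (vertex_edges E v) \<noteq> 2"
      using deg by (auto simp: vertex_degree_def)
    moreover have "{e, e'} \<subseteq> vertex_edges E v"
      using e by (auto simp: vertex_edges_def)
    moreover have "e \<noteq> e'"
      using neg e(5) by blast
    moreover have "finite (vertex_edges E v)"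
      using sub finite_subset by blast
    ultimately have "card (vertex_edges E v) > 2"
      using card_mono[of "vertex_edges E v" "{e, e'}"] by simp
    moreover have "card (vertex_edges E v) \<le> card {a, a'}"
      using sub by (intro card_mono) auto
    moreover have "card {a, a'} \<le> 2"
      by (simp add: card_insert_if)
    ultimately show False
      by linarith
  qed
  obtain u u' where u: "e0 = {u, u'}" "u \<in> V"
    using simple_graph_edgeE[OF sg e0] by metis
  have reach: "\<forall>e\<in>E. v \<in> e \<longrightarrow> conflict_free_color E f e c"
    if "(u, v) \<in> {(x, y). {x, y} \<in> E}\<^sup>*" for v
    using that
  proof (induction rule: rtrancl_induct)
    case base
    then show ?case
      using adj[OF e0 _ _ _ c] u by blast
  next
    case (step v w)
    then have "{v, w} \<in> E" "conflict_free_color E f {v, w} c"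
      by auto
    then show ?case
      using adj[of "{v, w}" _ w] by blast
  qed
  have "conflict_free_color E f e c" if e: "e \<in> E" for e
  proof -
    obtain v v' where "e = {v, v'}" "v \<in> V"
      using simple_graph_edgeE[OF sg e] by metis
    then show ?thesis
      using reach[of v] e T u(2) by (auto simp: is_tree_def graph_connected_def)
  qed
  then show ?thesis
    by blast
qed simp

text \<open>
  If one color is conflict-free for all edges, then its color class is an induced matching that
  meets every edge.  Such a matching is recorded by the states of the vertices: \<open>Out\<close> for
  uncovered vertices, \<open>Open\<close> for vertices matched within the current tree, \<open>Matched\<close> for vertices
  whose partner lies in a part of the tree that has been cut off.  \<open>L v\<close> is the set of
  states of \<open>v\<close> that extend to the parts cut off at \<open>v\<close>.
\<close>

datatype vstate = Out | Open | Matched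

text \<open>Two \<open>Out\<close> ends would leave an edge unmet by the matching. The partner of a
  \<open>Matched\<close> vertex lies outside the current tree, and as the matching is induced, no
  neighbour inside may be covered. Two \<open>Open\<close> ends may be partners; that they are is
  left to the uniqueness clause of \<open>solution\<close>.\<close>

fun compatible :: "vstate \<Rightarrow> vstate \<Rightarrow> bool" where
  "compatible Out t \<longleftrightarrow> t \<noteq> Out"
| "compatible Open t \<longleftrightarrow> t \<noteq> Matched"
| "compatible Matched t \<longleftrightarrow> t = Out"

definition solution :: "'a set \<Rightarrow> 'a set set \<Rightarrow> ('a \<Rightarrow> vstate \<Rightarrow> bool) \<Rightarrow> ('a \<Rightarrow> vstate) \<Rightarrow> bool" where
  "solution V E L s \<longleftrightarrow> (\<forall>v\<in>V. L v (s v)) \<and> (\<forall>x y. {x, y} \<in> E \<longrightarrow> compatible (s x) (s y)) \<and>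
     (\<forall>x\<in>V. s x = Open \<longrightarrow> (\<exists>!y. {x, y} \<in> E \<and> s y = Open))"

definition solvable :: "'a set \<Rightarrow> 'a set set \<Rightarrow> ('a \<Rightarrow> vstate \<Rightarrow> bool) \<Rightarrow> bool" where
  "solvable V E L \<longleftrightarrow> (\<exists>s. solution V E L s)"

text \<open>Nothing has been cut off yet, so \<open>Matched\<close> is forbidden everywhere. The
  \<open>Open\<close> vertices are the ends of the edges in the common color class, and conversely
  the edges with two \<open>Open\<close> ends form that class.\<close>

lemma two_coloring_iff_solvable:
  assumes T: "is_tree V E" and deg: "\<forall>v\<in>V. vertex_degree E v \<noteq> 2"
  shows "(\<exists>f. conflict_free_coloring E 2 f) \<longleftrightarrow> solvable V E (\<lambda>_ t. t \<noteq> Matched)"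
proof
  note sg = is_treeD(1)[OF T]
  assume "\<exists>f. conflict_free_coloring E 2 f"
  then obtain f c where c: "\<And>e. e \<in> E \<Longrightarrow> conflict_free_color E f e c"
    using two_coloring_common_color[OF T deg] by blast
  define s where "s x = (if \<exists>e\<in>E. x \<in> e \<and> f e = c then Open else Out)" for x
  have "solution V E (\<lambda>_ t. t \<noteq> Matched) s"
    unfolding solution_def
  proof (intro conjI ballI allI impI)
    fix x y assume xy: "{x, y} \<in> E"
    obtain e where "e \<in> edge_neighbourhood E {x, y}" "f e = c"
      using c[OF xy] unfolding conflict_free_color_def by blast
    then have "s x = Open \<or> s y = Open"
      by (auto simp: s_def in_edge_neighbourhood_iff)
    moreover have "s x \<noteq> Matched" "s y \<noteq> Matched"
      by (simp_all add: s_def)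
    ultimately show "compatible (s x) (s y)"
      by (cases "s x"; cases "s y") auto
  next
    fix x assume "x \<in> V" "s x = Open"
    then obtain e where e: "e \<in> E" "x \<in> e" "f e = c"
      by (auto simp: s_def split: if_splits)
    then obtain y where y: "e = {x, y}"
      using simple_graph_edgeE[OF sg e(1)] by (metis insert_commute insertE singletonD)
    show "\<exists>!y. {x, y} \<in> E \<and> s y = Open"
    proof
      show "{x, y} \<in> E \<and> s y = Open"
        using e y by (auto simp: s_def)
      fix z assume z: "{x, z} \<in> E \<and> s z = Open"
      then obtain e' where e': "e' \<in> E" "z \<in> e'" "f e' = c"
        by (auto simp: s_def split: if_splits)
      have "e = e'"
        using conflict_free_color_unique[OF c[of "{x, z}"] e(1) e'(1) _ e(2) _ e'(2) e(3) e'(3)] z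
        by blast
      then show "z = y"
        using e'(2) y simple_graph_edgeD(1)[OF sg, of x z] z by auto
    qed
  qed (simp add: s_def)
  then show "solvable V E (\<lambda>_ t. t \<noteq> Matched)"
    by (auto simp: solvable_def)
next
  note sg = is_treeD(1)[OF T]
  assume "solvable V E (\<lambda>_ t. t \<noteq> Matched)"
  then obtain s where nm: "\<And>x. x \<in> V \<Longrightarrow> s x \<noteq> Matched"
    and cp: "\<And>x y. {x, y} \<in> E \<Longrightarrow> compatible (s x) (s y)"
    and un: "\<And>x. x \<in> V \<Longrightarrow> s x = Open \<Longrightarrow> \<exists>!y. {x, y} \<in> E \<and> s y = Open"
    unfolding solvable_def solution_def by blast
  define f :: "'a set \<Rightarrow> nat" where "f e = (if \<forall>x\<in>e. s x = Open then 1 else 0)" for e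
  have "conflict_free_color E f e 1" if e: "e \<in> E" for e
  proof -
    obtain x y where xy: "e = {x, y}" "s x = Open" "x \<in> V"
    proof -
      obtain x y where xy: "e = {x, y}" "x \<in> V" "y \<in> V"
        using simple_graph_edgeE[OF sg e] by metis
      have "s x = Open \<or> s y = Open"
        using cp[of x y] nm[of x] nm[of y] e xy by (cases "s x"; cases "s y") auto
      then show thesis
        using that xy by (metis insert_commute)
    qed
    obtain z where z: "{x, z} \<in> E" "s z = Open" and zu: "\<And>w. {x, w} \<in> E \<Longrightarrow> s w = Open \<Longrightarrow> w = z"
      using un[OF xy(3,2)] by blast
    show ?thesis
      unfolding conflict_free_color_def
    proof (rule ex1I[of _ "{x, z}"])
      show "{x, z} \<in> edge_neighbourhood E e \<and> f {x, z} = 1"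
        using z xy by (auto simp: in_edge_neighbourhood_iff f_def)
      fix e' assume e': "e' \<in> edge_neighbourhood E e \<and> f e' = 1"
      then have op: "\<And>w. w \<in> e' \<Longrightarrow> s w = Open" and e'E: "e' \<in> E"
        by (auto simp: f_def in_edge_neighbourhood_iff split: if_splits)
      \<comment> \<open>Otherwise \<open>e'\<close> joins \<open>y\<close> to an \<open>Open\<close>
        vertex \<open>w\<close>. Then \<open>x\<close> and \<open>w\<close> are both
        \<open>Open\<close> neighbours of the \<open>Open\<close> vertex \<open>y\<close>, so they
        coincide.\<close>
      have "x \<in> e'"
      proof (rule ccontr)
        assume nx: "x \<notin> e'"
        then have ye': "y \<in> e'"
          using e' xy by (auto simp: in_edge_neighbourhood_iff)
        then obtain w where w: "e' = {y, w}"
          using simple_graph_edgeE[OF sg e'E] by (metis insert_commute insertE singletonD)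
        have "y \<in> V"
          using simple_graph_edgeD[OF sg, of x y] e xy by auto
        then have "w = x"
          using un[of y] op ye' w e'E e xy by (metis insert_commute insert_iff)
        then show False
          using nx w by simp
      qed
      then obtain w where w: "e' = {x, w}"
        using simple_graph_edgeE[OF sg e'E] by (metis insert_commute insertE singletonD)
      then show "e' = {x, z}"
        using zu[of w] op e'E by auto
    qed
  qed
  then have "conflict_free_coloring E 2 f"
    by (auto simp: conflict_free_coloring_def f_def)
  then show "\<exists>f. conflict_free_coloring E 2 f"
    by blast
qed

text \<open>The states left to \<open>p\<close> once its leaf \<open>v\<close> is cut off. If
  \<open>p\<close> is uncovered, \<open>v\<close> must have its partner in a part cut off earlier.
  If \<open>p\<close> is matched in what remains, \<open>v\<close> is uncovered. If \<open>p\<close>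
  counts as matched behind it, either this was so before and \<open>v\<close> is uncovered, or
  \<open>p\<close> and \<open>v\<close> are now partners.\<close>

fun absorb :: "(vstate \<Rightarrow> bool) \<Rightarrow> (vstate \<Rightarrow> bool) \<Rightarrow> vstate \<Rightarrow> bool" where
  "absorb Lp Lv Out \<longleftrightarrow> Lp Out \<and> Lv Matched"
| "absorb Lp Lv Open \<longleftrightarrow> Lp Open \<and> Lv Out"
| "absorb Lp Lv Matched \<longleftrightarrow> Lp Matched \<and> Lv Out \<or> Lp Open \<and> Lv Open"

text \<open>The only possible partner of an \<open>Open\<close> leaf \<open>v\<close> is
  \<open>p\<close>. Solutions are translated by changing the state of \<open>p\<close> exactly when
  these two are matched with each other.\<close>

lemma solvable_remove_leaf:
  assumes sg: "simple_graph V E" and v: "v \<in> V" "nbrs E v = {p}"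
    and L': "\<And>x. x \<in> V - {v} \<Longrightarrow> x \<noteq> p \<Longrightarrow> L' x = L x" "L' p = absorb (L p) (L v)"
  shows "solvable V E L \<longleftrightarrow> solvable (V - {v}) (E - {{v, p}}) L'"
proof
  have vp: "{v, p} \<in> E" "v \<noteq> p" "p \<in> V"
    using v simple_graph_edgeD[OF sg, of v p] by (auto simp: nbrs_def)
  have nv: "{v, x} \<in> E \<longleftrightarrow> x = p" for x
    using v(2) by (auto simp: nbrs_def)
  have nv': "{x, v} \<in> E \<longleftrightarrow> x = p" for x
    using nv[of x] by (simp add: insert_commute)
  assume "solvable V E L"
  then obtain s where L: "\<And>x. x \<in> V \<Longrightarrow> L x (s x)"
    and cp: "\<And>x y. {x, y} \<in> E \<Longrightarrow> compatible (s x) (s y)"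
    and un: "\<And>x. x \<in> V \<Longrightarrow> s x = Open \<Longrightarrow> \<exists>!y. {x, y} \<in> E \<and> s y = Open"
    unfolding solvable_def solution_def by blast
  have E': "{x, y} \<in> E - {{v, p}} \<longleftrightarrow> {x, y} \<in> E \<and> x \<noteq> v \<and> y \<noteq> v" for x y
    using nv nv' by (auto simp: doubleton_eq_iff)
  have open_v: "s p = Open" if "s v = Open"
    using un[OF v(1) that] nv by auto
  show "solvable (V - {v}) (E - {{v, p}}) L'"
  proof (cases "s v = Open")
    case True
    then have sp: "s p = Open"
      by (rule open_v)
    have others: "s y = Out" if "{p, y} \<in> E" "y \<noteq> v" for y
    proof -
      have "s y \<noteq> Open"
        using un[OF vp(3) sp] True that nv' by blast
      then show ?thesis
        using cp[OF that(1)] sp by (cases "s y") auto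
    qed
    have others': "s y = Out" if "{y, p} \<in> E" "y \<noteq> v" for y
      using others that by (simp add: insert_commute)
    \<comment> \<open>Since \<open>v\<close> is the one \<open>Open\<close> neighbour of
      \<open>p\<close>, all others are \<open>Out\<close>, which is what \<open>p\<close> needs in
      order to become \<open>Matched\<close>.\<close>
    have "solution (V - {v}) (E - {{v, p}}) L' (s(p := Matched))"
      unfolding solution_def E'
    proof (intro conjI ballI allI impI)
      fix x assume x: "x \<in> V - {v}"
      then show "L' x ((s(p := Matched)) x)"
        using L[of x] L[OF v(1)] L[OF vp(3)] L' sp True by auto
    next
      fix x y assume "{x, y} \<in> E \<and> x \<noteq> v \<and> y \<noteq> v"
      then show "compatible ((s(p := Matched)) x) ((s(p := Matched)) y)"
        using cp[of x y] others others' simple_graph_edgeD(1)[OF sg, of x y] by auto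
    next
      fix x assume x: "x \<in> V - {v}" "(s(p := Matched)) x = Open"
      then have xp: "x \<noteq> p" "s x = Open"
        by (auto split: if_splits)
      then have xpE: "{x, p} \<notin> E"
        using others'[of x] x by auto
      obtain y where y: "{x, y} \<in> E" "s y = Open"
        and yu: "\<And>z. {x, z} \<in> E \<Longrightarrow> s z = Open \<Longrightarrow> z = y"
        using un[of x] x xp by blast
      have "y \<noteq> v" "y \<noteq> p"
        using nv'[of x] xp y(1) xpE by auto
      show "\<exists>!y. ({x, y} \<in> E \<and> x \<noteq> v \<and> y \<noteq> v) \<and> (s(p := Matched)) y = Open"
      proof (rule ex1I[of _ y])
        show "z = y" if "({x, z} \<in> E \<and> x \<noteq> v \<and> z \<noteq> v) \<and> (s(p := Matched)) z = Open" for z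
          using yu[of z] that by (auto split: if_splits)
      qed (use x y \<open>y \<noteq> v\<close> \<open>y \<noteq> p\<close> in simp)
    qed
    then show ?thesis
      by (auto simp: solvable_def)
  next
    case False
    have "solution (V - {v}) (E - {{v, p}}) L' s"
      unfolding solution_def E'
    proof (intro conjI ballI allI impI)
      fix x assume x: "x \<in> V - {v}"
      show "L' x (s x)"
        using L[of x] L[OF v(1)] L[OF vp(3)] L' cp[OF vp(1)] False x
        by (cases "x = p"; cases "s v"; cases "s p") auto
    next
      fix x assume x: "x \<in> V - {v}" "s x = Open"
      then obtain y where y: "{x, y} \<in> E" "s y = Open"
        and yu: "\<And>z. {x, z} \<in> E \<Longrightarrow> s z = Open \<Longrightarrow> z = y"
        using un[of x] x by blast
      show "\<exists>!y. ({x, y} \<in> E \<and> x \<noteq> v \<and> y \<noteq> v) \<and> s y = Open"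
      proof (rule ex1I[of _ y])
        show "z = y" if "({x, z} \<in> E \<and> x \<noteq> v \<and> z \<noteq> v) \<and> s z = Open" for z
          using yu[of z] that by simp
      qed (use x y False in auto)
    qed (use cp in auto)
    then show ?thesis
      by (auto simp: solvable_def)
  qed
next
  have vp: "{v, p} \<in> E" "v \<noteq> p" "p \<in> V"
    using v simple_graph_edgeD[OF sg, of v p] by (auto simp: nbrs_def)
  have nv: "{v, x} \<in> E \<longleftrightarrow> x = p" for x
    using v(2) by (auto simp: nbrs_def)
  have nv': "{x, v} \<in> E \<longleftrightarrow> x = p" for x
    using nv[of x] by (simp add: insert_commute)
  have E': "{x, y} \<in> E - {{v, p}} \<longleftrightarrow> {x, y} \<in> E \<and> x \<noteq> v \<and> y \<noteq> v" for x y
    using nv nv' by (auto simp: doubleton_eq_iff)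
  assume "solvable (V - {v}) (E - {{v, p}}) L'"
  then obtain s where s: "solution (V - {v}) (E - {{v, p}}) L' s"
    by (auto simp: solvable_def)
  have L: "L' x (s x)" if "x \<in> V - {v}" for x
    using s that by (simp add: solution_def)
  have cp: "compatible (s x) (s y)" if "{x, y} \<in> E" "x \<noteq> v" "y \<noteq> v" for x y
    using s that by (simp add: solution_def E' del: Diff_iff)
  have un: "\<exists>!y. ({x, y} \<in> E \<and> x \<noteq> v \<and> y \<noteq> v) \<and> s y = Open"
    if "x \<in> V - {v}" "s x = Open" for x
    using s that unfolding solution_def E' by simp
  have Lp: "absorb (L p) (L v) (s p)"
    using L[of p] L'(2) vp by auto
  \<comment> \<open>\<open>Matched\<close> at \<open>p\<close> can have two origins in
    \<open>absorb\<close>. The new pair \<open>v\<close>, \<open>p\<close> is restored whenever both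
    could be \<open>Open\<close>; otherwise the state of \<open>p\<close> stays.\<close>
  show "solvable V E L"
  proof (cases "s p = Matched \<and> L p Open \<and> L v Open")
    case True
    have others: "s y = Out" if "{p, y} \<in> E" "y \<noteq> v" for y
      using cp[OF that(1)] vp(2) that True by simp
    have others': "s y = Out" if "{y, p} \<in> E" "y \<noteq> v" for y
      using others that by (simp add: insert_commute)
    let ?s = "s(p := Open, v := Open)"
    have "solution V E L ?s"
      unfolding solution_def
    proof (intro conjI ballI allI impI)
      fix x assume x: "x \<in> V"
      then show "L x (?s x)"
        using L[of x] L'(1)[of x] True by auto
    next
      fix x y assume xy: "{x, y} \<in> E"
      then show "compatible (?s x) (?s y)"
        using cp[OF xy] nv nv' others others' by auto
    next
      fix x assume x: "x \<in> V" "?s x = Open"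
      consider "x = v" | "x = p" "x \<noteq> v" | "x \<noteq> v" "x \<noteq> p"
        by blast
      then show "\<exists>!y. {x, y} \<in> E \<and> ?s y = Open"
      proof cases
        case 1
        then show ?thesis
          using nv by auto
      next
        case 2
        have "y = v" if "{p, y} \<in> E" "?s y = Open" for y
          using others[of y] that simple_graph_edgeD(1)[OF sg that(1)] by (auto split: if_splits)
        then show ?thesis
          using 2 nv' by (intro ex1I[of _ v]) auto
      next
        case 3
        then have sx: "s x = Open" "{x, p} \<notin> E"
          using x others'[of x] by auto
        then obtain y where y: "{x, y} \<in> E" "y \<noteq> v" "s y = Open"
          and yu: "\<And>z. {x, z} \<in> E \<Longrightarrow> z \<noteq> v \<Longrightarrow> s z = Open \<Longrightarrow> z = y"
          using un[of x] x 3 by blast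
        have "y \<noteq> p"
          using y(1) sx by auto
        show ?thesis
        proof (rule ex1I[of _ y])
          show "z = y" if "{x, z} \<in> E \<and> ?s z = Open" for z
            using yu[of z] that sx(2) nv'[of x] 3 by (auto split: if_splits)
        qed (use y \<open>y \<noteq> p\<close> in simp)
      qed
    qed
    then show ?thesis
      by (auto simp: solvable_def)
  next
    case False
    \<comment> \<open>The state forced on a leaf that is not matched with \<open>p\<close>: beside
      an uncovered \<open>p\<close> it must be covered from behind, beside a covered one it must be
      uncovered.\<close>
    define t where "t = (if s p = Out then Matched else Out)"
    have t: "L p (s p)" "L v t" "compatible t (s p)" "compatible (s p) t" "t \<noteq> Open"
      using Lp False by (cases "s p"; auto simp: t_def)+
    let ?s = "s(v := t)"
    have "solution V E L ?s"
      unfolding solution_def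
    proof (intro conjI ballI allI impI)
      fix x assume x: "x \<in> V"
      then show "L x (?s x)"
        using L[of x] L'(1)[of x] t by (cases "x = p") auto
    next
      fix x y assume xy: "{x, y} \<in> E"
      consider "x = v" "y = p" | "y = v" "x = p" | "x \<noteq> v" "y \<noteq> v"
        using xy nv[of y] nv'[of x] by blast
      then show "compatible (?s x) (?s y)"
        by cases (use cp[OF xy] t vp in auto)
    next
      fix x assume x: "x \<in> V" "?s x = Open"
      then have "x \<noteq> v" "s x = Open"
        using t by (auto split: if_splits)
      then obtain y where y: "{x, y} \<in> E" "y \<noteq> v" "s y = Open"
        and yu: "\<And>z. {x, z} \<in> E \<Longrightarrow> z \<noteq> v \<Longrightarrow> s z = Open \<Longrightarrow> z = y"
        using un[of x] x by blast
      show "\<exists>!y. {x, y} \<in> E \<and> ?s y = Open"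
      proof (rule ex1I[of _ y])
        show "z = y" if "{x, z} \<in> E \<and> ?s z = Open" for z
          using yu[of z] that t(5) by (auto split: if_splits)
      qed (use y in simp)
    qed
    then show ?thesis
      by (auto simp: solvable_def)
  qed
qed

text \<open>A lone vertex has no partner inside the tree, so \<open>Open\<close> is impossible. This
  is the test made by \<open>answer\<close>.\<close>

lemma solvable_singleton: "solvable {v} {} L \<longleftrightarrow> L v Out \<or> L v Matched"
proof
  assume "solvable {v} {} L"
  then obtain s where "L v (s v)" "s v \<noteq> Open"
    by (auto simp: solvable_def solution_def)
  then show "L v Out \<or> L v Matched"
    by (cases "s v") auto
next
  assume "L v Out \<or> L v Matched"
  then have "solution {v} {} L (\<lambda>_. if L v Out then Out else Matched)"
    by (auto simp: solution_def)
  then show "solvable {v} {} L"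
    by (auto simp: solvable_def)
qed

text \<open>
  In a rooted tree let every vertex with children mark one edge to a child; a marked edge gets
  color 1 or 2 according to the parity of the depth of its upper end, all other edges get color 0.
  The color of the edge marked by the upper end of \<open>e\<close> is conflict-free for \<open>e\<close>.
  Here \<open>q\<close> is the parity and \<open>up e\<close> the upper end of \<open>e\<close>.
\<close>

lemma tree_layered_coloring:
  assumes "is_tree V E"
  shows "\<exists>(q :: 'a \<Rightarrow> nat) up f. (\<forall>x. q x = 1 \<or> q x = 2) \<and>
    (\<forall>x y. {x, y} \<in> E \<longrightarrow> q x \<noteq> q y) \<and>
    (\<forall>e\<in>E. up e \<in> e \<and> (f e = 0 \<or> f e = q (up e))) \<and>
    (\<forall>e\<in>E. \<exists>e'\<in>E. up e' = up e \<and> f e' = q (up e)) \<and>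
    (\<forall>e\<in>E. \<forall>e'\<in>E. up e = up e' \<longrightarrow> f e = q (up e) \<longrightarrow> f e' = q (up e) \<longrightarrow> e = e') \<and>
    (\<forall>e\<in>E. \<forall>e'\<in>E. \<forall>x. x \<in> e \<longrightarrow> x \<in> e' \<longrightarrow> up e \<noteq> x \<longrightarrow> up e' \<noteq> x \<longrightarrow> e = e')"
  using assms
proof (induction rule: tree_induct)
  case (single v)
  then show ?case
    by (intro exI[of _ "\<lambda>_. 1"]) simp
next
  case (leaf V E v p)
  obtain q :: "'a \<Rightarrow> nat" and up f where IH:
    "\<forall>x. q x = 1 \<or> q x = 2"
    "\<forall>x y. {x, y} \<in> E \<longrightarrow> q x \<noteq> q y"
    "\<forall>e\<in>E. up e \<in> e \<and> (f e = 0 \<or> f e = q (up e))"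
    "\<forall>e\<in>E. \<exists>e'\<in>E. up e' = up e \<and> f e' = q (up e)"
    "\<forall>e\<in>E. \<forall>e'\<in>E. up e = up e' \<longrightarrow> f e = q (up e) \<longrightarrow> f e' = q (up e) \<longrightarrow> e = e'"
    "\<forall>e\<in>E. \<forall>e'\<in>E. \<forall>x. x \<in> e \<longrightarrow> x \<in> e' \<longrightarrow> up e \<noteq> x \<longrightarrow> up e' \<noteq> x \<longrightarrow> e = e'"
    using leaf(4) by (elim exE conjE) (rule that)
  have nv: "v \<notin> e" if "e \<in> E" for e
    using that leaf is_treeD(1)[OF leaf(1)] by (auto simp: simple_graph_def)
  then have new: "{v, p} \<notin> E"
    by blast
  have upV: "up e \<noteq> v" if "e \<in> E" for e
    using IH(3) nv that by metis
  have vp: "v \<noteq> p"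
    using leaf by auto
  \<comment> \<open>Subtraction from 3 exchanges the parities 1 and 2.\<close>
  define q' where "q' = q(v := 3 - q p)"
  define up' where "up' = up({v, p} := p)"
  \<comment> \<open>The new edge is marked exactly if it is the first edge leading down from
    \<open>p\<close>.\<close>
  define f' where "f' = f({v, p} := (if \<exists>e\<in>E. up e = p then 0 else q p))"
  have q': "q' x = q x" if "x \<noteq> v" for x
    using that by (simp add: q'_def)
  have old: "up' e = up e" "f' e = f e" if "e \<in> E" for e
    using that new by (auto simp: up'_def f'_def)
  have upn: "up' {v, p} = p" "f' {v, p} = (if \<exists>e\<in>E. up e = p then 0 else q p)"
    by (auto simp: up'_def f'_def)
  have qp: "q' p = q p" "q' v \<noteq> q p" "q p \<noteq> 0"
    using IH(1)[rule_format, of p] vp by (auto simp: q'_def)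
  show ?case
  proof (intro exI[of _ q'] exI[of _ up'] exI[of _ f'] conjI)
    show "\<forall>x. q' x = 1 \<or> q' x = 2"
    proof
      fix x show "q' x = 1 \<or> q' x = 2"
        using IH(1)[rule_format, of p] IH(1)[rule_format, of x] by (auto simp: q'_def)
    qed
    show "\<forall>x y. {x, y} \<in> insert {v, p} E \<longrightarrow> q' x \<noteq> q' y"
    proof (intro allI impI)
      fix x y assume "{x, y} \<in> insert {v, p} E"
      then consider "x = v" "y = p" | "x = p" "y = v" | "{x, y} \<in> E"
        by (auto simp: doubleton_eq_iff)
      then show "q' x \<noteq> q' y"
      proof cases
        case 3
        then show ?thesis
          using IH(2) nv q' by (metis insertCI)
      qed (use qp in auto)
    qed
    show "\<forall>e\<in>insert {v, p} E. up' e \<in> e \<and> (f' e = 0 \<or> f' e = q' (up' e))"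
      using IH(3) old upn qp upV q' by auto
    show "\<forall>e\<in>insert {v, p} E. \<exists>e'\<in>insert {v, p} E. up' e' = up' e \<and> f' e' = q' (up' e)"
    proof
      fix e assume e: "e \<in> insert {v, p} E"
      show "\<exists>e'\<in>insert {v, p} E. up' e' = up' e \<and> f' e' = q' (up' e)"
      proof (cases "e = {v, p} \<and> \<not> (\<exists>e\<in>E. up e = p)")
        case True
        then show ?thesis
          using upn qp by auto
      next
        case False
        then obtain e1 where e1: "e1 \<in> E" "up' e = up e1"
          using e upn old by auto
        then obtain e' where "e' \<in> E" "up e' = up e1" "f e' = q (up e1)"
          using IH(4) by blast
        then show ?thesis
          using e1 old q' upV by auto
      qed
    qed
    show "\<forall>e\<in>insert {v, p} E. \<forall>e'\<in>insert {v, p} E. up' e = up' e' \<longrightarrow>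
        f' e = q' (up' e) \<longrightarrow> f' e' = q' (up' e) \<longrightarrow> e = e'"
      using IH(5) old upn qp upV q' by (auto split: if_splits)
    have fresh: "e = {v, p}" if "e \<in> insert {v, p} E" "v \<in> e" for e
      using that nv by auto
    show "\<forall>e\<in>insert {v, p} E. \<forall>e'\<in>insert {v, p} E. \<forall>x. x \<in> e \<longrightarrow> x \<in> e' \<longrightarrow>
        up' e \<noteq> x \<longrightarrow> up' e' \<noteq> x \<longrightarrow> e = e'"
      using IH(6) old upn fresh nv by auto
  qed
qed

text \<open>Let \<open>e\<close> have upper end \<open>u\<close> and lower end \<open>w\<close>. A
  nonzero color reveals the parity of the upper end of its edge, and \<open>w\<close> and the parent
  of \<open>u\<close> have the opposite parity to \<open>u\<close>. So only an edge with upper end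
  \<open>u\<close> can repeat the color, and just one of those is marked.\<close>

lemma tree_three_coloring:
  assumes T: "is_tree V E"
  shows "\<exists>f. conflict_free_coloring E 3 f"
proof -
  note sg = is_treeD(1)[OF T]
  obtain q :: "'a \<Rightarrow> nat" and up f where H:
    "\<forall>x. q x = 1 \<or> q x = 2"
    "\<forall>x y. {x, y} \<in> E \<longrightarrow> q x \<noteq> q y"
    "\<forall>e\<in>E. up e \<in> e \<and> (f e = 0 \<or> f e = q (up e))"
    "\<forall>e\<in>E. \<exists>e'\<in>E. up e' = up e \<and> f e' = q (up e)"
    "\<forall>e\<in>E. \<forall>e'\<in>E. up e = up e' \<longrightarrow> f e = q (up e) \<longrightarrow> f e' = q (up e) \<longrightarrow> e = e'"
    "\<forall>e\<in>E. \<forall>e'\<in>E. \<forall>x. x \<in> e \<longrightarrow> x \<in> e' \<longrightarrow> up e \<noteq> x \<longrightarrow> up e' \<noteq> x \<longrightarrow> e = e'"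
    using tree_layered_coloring[OF T] by (elim exE conjE) (rule that)
  have q0: "q x \<noteq> 0" for x
    using H(1)[rule_format, of x] by auto
  have "f e < 3" if "e \<in> E" for e
    using H(1)[rule_format, of "up e"] H(3)[rule_format, OF that] by auto
  moreover have "conflict_free_color E f e (q (up e))" if e: "e \<in> E" for e
  proof -
    obtain e1 where e1: "e1 \<in> E" "up e1 = up e" "f e1 = q (up e)"
      using H(4) e by blast
    obtain w where w: "e = {up e, w}"
      using simple_graph_edgeE[OF sg e] H(3) e by (metis insert_commute insertE singletonD)
    have qw: "q w \<noteq> q (up e)"
      using H(2) w e by metis
    show ?thesis
      unfolding conflict_free_color_def
    proof (rule ex1I[of _ e1])
      show "e1 \<in> edge_neighbourhood E e \<and> f e1 = q (up e)"
        using e1 H(3) e by (metis in_edge_neighbourhood_iff)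
      fix e2 assume e2: "e2 \<in> edge_neighbourhood E e \<and> f e2 = q (up e)"
      then have E2: "e2 \<in> E"
        by (simp add: in_edge_neighbourhood_iff)
      have q2: "q (up e2) = q (up e)"
        using H(3) E2 e2 q0 by metis
      have "up e2 = up e"
      proof (rule ccontr)
        assume ne: "up e2 \<noteq> up e"
        consider "up e \<in> e2" | "w \<in> e2"
          using e2 w by (metis in_edge_neighbourhood_iff insertE singletonD)
        then show False
        proof cases
          case 1
          then have "e2 = {up e2, up e}"
            using simple_graph_edgeE[OF sg E2] H(3) E2 ne
            by (metis doubleton_eq_iff insertE singletonD)
          then show False
            using H(2) E2 q2 by metis
        next
          case 2
          have "up e2 \<noteq> w"
            using q2 qw by auto
          moreover have "up e \<noteq> w"
            using qw by auto
          ultimately have "e = e2"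
            using H(6) e E2 2 w by (metis insertCI)
          then show False
            using ne by simp
        qed
      qed
      then show "e2 = e1"
        using H(5) E2 e1 e2 by metis
    qed
  qed
  ultimately show ?thesis
    by (auto simp: conflict_free_coloring_def)
qed

section \<open>The exact value of the index\<close>

lemma conflict_free_coloring_mono:
  "conflict_free_coloring E k f \<Longrightarrow> k \<le> l \<Longrightarrow> conflict_free_coloring E l f"
  by (force simp: conflict_free_coloring_def)

text \<open>With a single color, a leaf edge and an edge adjacent to it repeat that color.\<close>

lemma tree_coloring_ge_2:
  assumes T: "is_tree V E" and V: "card V \<ge> 3" and f: "conflict_free_coloring E k f"
  shows "k \<ge> 2"
proof (rule ccontr)
  assume "\<not> k \<ge> 2"
  then have z: "f e = 0" if "e \<in> E" for e
    using f that by (fastforce simp: conflict_free_coloring_def)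
  obtain v p where v: "v \<in> V" "nbrs E v = {p}"
    using tree_has_leaf[OF T] V by auto
  note r = tree_remove_leaf[OF T v]
  have "card (V - {v}) \<ge> 2"
    using V v(1) is_treeD(2)[OF T] by simp
  then obtain w where w: "{p, w} \<in> E - {{v, p}}"
    using tree_has_nbr[OF r(1,2)] by blast
  obtain c where c: "conflict_free_color E f {v, p} c"
    using f r(3) by (auto simp: conflict_free_coloring_def)
  then have "c = 0"
    using z by (auto simp: conflict_free_color_def in_edge_neighbourhood_iff)
  then have "{v, p} = {p, w}"
    using conflict_free_color_unique[OF c r(3), of "{p, w}" p p] w z r(3) by simp
  then show False
    using w by simp
qed

text \<open>The lower bound 2 starts at three vertices; one vertex needs no color and one edge needs
  one, hence \<open>card V - 1\<close> below that.\<close>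

theorem cf_chromatic_index_tree:
  assumes T: "is_tree V E" and deg: "\<forall>v\<in>V. vertex_degree E v \<noteq> 2"
  shows "cf_chromatic_index E =
    (if card V < 3 then card V - 1 else if solvable V E (\<lambda>_ t. t \<noteq> Matched) then 2 else 3)"
proof -
  have cE: "card V = Suc (card E)"
    using tree_card_edges[OF T] .
  consider "card V = 1" | "card V = 2" | "card V \<ge> 3"
    using cE by linarith
  then show ?thesis
  proof cases
    case 1
    then have "E = {}"
      using cE tree_edges_finite[OF T] by simp
    then have "conflict_free_coloring E 0 (\<lambda>_. 0)"
      by (simp add: conflict_free_coloring_def)
    then show ?thesis
      using 1 unfolding cf_chromatic_index_def by (auto intro: Least_equality)
  next
    case 2
    then obtain e where e: "E = {e}"
      using cE by (auto simp: card_1_singleton_iff)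
    then have "e \<noteq> {}"
      using simple_graph_edgeE[OF is_treeD(1)[OF T]] by blast
    then have "conflict_free_color E (\<lambda>_. 0) e 0"
      using e unfolding conflict_free_color_def by (intro ex1I[of _ e]) (auto simp: in_edge_neighbourhood_iff)
    then have "conflict_free_coloring E 1 (\<lambda>_. 0)"
      using e by (auto simp: conflict_free_coloring_def)
    moreover have "1 \<le> k" if "conflict_free_coloring E k f" for k f
      using that e by (auto simp: conflict_free_coloring_def)
    ultimately have "cf_chromatic_index E = 1"
      unfolding cf_chromatic_index_def by (intro Least_equality) auto
    then show ?thesis
      using 2 by simp
  next
    case 3
    note ge2 = tree_coloring_ge_2[OF T 3]
    note iff2 = two_coloring_iff_solvable[OF T deg]
    show ?thesis
    proof (cases "solvable V E (\<lambda>_ t. t \<noteq> Matched)")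
      case True
      then have "cf_chromatic_index E = 2"
        unfolding cf_chromatic_index_def using iff2 ge2 by (intro Least_equality) auto
      then show ?thesis
        using 3 True by simp
    next
      case False
      have "3 \<le> k" if k: "conflict_free_coloring E k f" for k f
      proof (rule ccontr)
        assume "\<not> 3 \<le> k"
        then have "conflict_free_coloring E 2 f"
          using conflict_free_coloring_mono[OF k] by simp
        then show False
          using False iff2 by blast
      qed
      then have "cf_chromatic_index E = 3"
        unfolding cf_chromatic_index_def using tree_three_coloring[OF T]
        by (intro Least_equality) auto
      then show ?thesis
        using 3 False by simp
    qed
  qed
qed

section \<open>Weakest preconditions with running times\<close>

text \<open>Asking for a halting run covers termination and the word bound; passing the time to the
  postcondition lets correctness and cost be proved together.\<close>

definition wp :: "nat \<Rightarrow> program \<Rightarrow> (nat \<Rightarrow> machine_state \<Rightarrow> bool) \<Rightarrow> machine_state \<Rightarrow> bool" where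
  "wp W P Q s \<longleftrightarrow> (\<exists>t s'. exec W P s t s' \<and> Q t s')"

lemma wp_mono: "wp W P Q s \<Longrightarrow> (\<And>t s'. Q t s' \<Longrightarrow> Q' t s') \<Longrightarrow> wp W P Q' s"
  unfolding wp_def by blast

text \<open>Without this rule the simplifier would unfold the rest of a program before its first command.\<close>

lemma wp_cong: "P = P' \<Longrightarrow> s = s' \<Longrightarrow> wp W P Q s = wp W P' Q s'"
  by simp

lemma wp_simps:
  "wp W Skip Q s \<longleftrightarrow> Q 1 s"
  "wp W (Move r a) Q (R, M) \<longleftrightarrow> operand_val R a < W \<and> Q 1 (R(r := operand_val R a), M)"
  "wp W (Add r a b) Q (R, M) \<longleftrightarrow> operand_val R a + operand_val R b < W \<and>
     Q 1 (R(r := operand_val R a + operand_val R b), M)"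
  "wp W (Sub r a b) Q (R, M) \<longleftrightarrow> operand_val R a - operand_val R b < W \<and>
     Q 1 (R(r := operand_val R a - operand_val R b), M)"
  "wp W (Load r a) Q (R, M) \<longleftrightarrow> operand_val R a < W \<and> M (operand_val R a) < W \<and>
     Q 1 (R(r := M (operand_val R a)), M)"
  "wp W (Store a b) Q (R, M) \<longleftrightarrow> operand_val R a < W \<and> operand_val R b < W \<and>
     Q 1 (R, M(operand_val R a := operand_val R b))"
  "wp W (IfElse c P P') Q s \<longleftrightarrow>
     (if test_val (fst s) c then wp W P (\<lambda>t. Q (1 + t)) s else wp W P' (\<lambda>t. Q (1 + t)) s)"
  unfolding wp_def
  by (auto simp: exec.simps[of W Skip] exec.simps[of W "Move r a"] exec.simps[of W "Add r a b"]
      exec.simps[of W "Sub r a b"] exec.simps[of W "Load r a"] exec.simps[of W "Store a b"]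
      exec.simps[of W "IfElse c P P'"])

lemma wp_Seq: "wp W (Seq P P') Q s \<longleftrightarrow> wp W P (\<lambda>t. wp W P' (\<lambda>u. Q (t + u))) s"
proof
  assume "wp W (Seq P P') Q s"
  then obtain t u s' s'' where "exec W P s t s'" "exec W P' s' u s''" "Q (t + u) s''"
    unfolding wp_def by (auto simp: exec.simps[of W "Seq P P'"])
  then show "wp W P (\<lambda>t. wp W P' (\<lambda>u. Q (t + u))) s"
    unfolding wp_def by blast
next
  assume "wp W P (\<lambda>t. wp W P' (\<lambda>u. Q (t + u))) s"
  then show "wp W (Seq P P') Q s"
    unfolding wp_def by (blast intro: exec_Seq)
qed

text \<open>The index of the invariant is a time budget from which each pass pays for its test and
  body, so amortized bounds come directly from the choice of \<open>I\<close>. The extra 1 is the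
  final failing test.\<close>

lemma wp_While:
  assumes step: "\<And>k s. I k s \<Longrightarrow> test_val (fst s) b \<Longrightarrow>
      wp W P (\<lambda>t s'. \<exists>k'. I k' s' \<and> 1 + t + k' \<le> k) s"
    and init: "I k s"
  shows "wp W (While b P) (\<lambda>t s'. t \<le> k + 1 \<and> (\<exists>k'. I k' s' \<and> \<not> test_val (fst s') b)) s"
  using init
proof (induction k arbitrary: s rule: less_induct)
  case (less k)
  show ?case
  proof (cases "test_val (fst s) b")
    case True
    then obtain t s' k' where 1: "exec W P s t s'" "I k' s'" "1 + t + k' \<le> k"
      using step[OF less(2)] by (auto simp: wp_def)
    then have "wp W (While b P) (\<lambda>t s'. t \<le> k' + 1 \<and> (\<exists>k'. I k' s' \<and> \<not> test_val (fst s') b)) s'"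
      using less(1)[of k' s'] by simp
    then obtain u s'' where 2: "exec W (While b P) s' u s''" "u \<le> k' + 1"
        "\<exists>k'. I k' s'' \<and> \<not> test_val (fst s'') b"
      unfolding wp_def by blast
    have "exec W (While b P) s (1 + t + u) s''"
      using True 1(1) 2(1) by (rule exec_WhileTrue)
    moreover have "1 + t + u \<le> k + 1"
      using 1 2 by simp
    ultimately show ?thesis
      using 2(3) unfolding wp_def by blast
  next
    case False
    then have "exec W (While b P) s 1 s"
      by (rule exec_WhileFalse)
    then show ?thesis
      using False less(2) unfolding wp_def by (intro exI[of _ 1] exI[of _ s]) auto
  qed
qed

fun block :: "program list \<Rightarrow> program" where
  "block [] = Skip"
| "block (P # Ps) = Seq P (block Ps)"

section \<open>The program\<close>

text \<open>
  The program keeps, for every vertex of the remaining tree, its degree and the sum of its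
  neighbours.  The sum at a leaf is the neighbour of the leaf, so no adjacency lists are needed.
  Besides, the states of a vertex are stored as bits, with the bits for \<open>Out\<close> and \<open>Open\<close>
  inverted so that the initial memory describes the initial set of states.

  The arrays start at addresses \<open>2 * n\<close> (degree), \<open>3 * n\<close> (sum), \<open>4 * n\<close> (not \<open>Out\<close>),
  \<open>5 * n\<close> (not \<open>Open\<close>), \<open>6 * n\<close> (\<open>Matched\<close>); registers 3 to 7 hold these addresses.
  Register 1 holds \<open>n\<close>, register 2 the number of edges, register 8 the loop counter, register 9
  the reading position or the current vertex, and register 13 the neighbour of the leaf that was
  removed last, which is the root in the end.
\<close>

definition set_bases :: program where
  "set_bases = block [Load 1 (Const 0), Load 2 (Const 1),
     Add 3 (Reg 1) (Reg 1), Add 4 (Reg 3) (Reg 1), Add 5 (Reg 4) (Reg 1), Add 6 (Reg 5) (Reg 1),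
     Add 7 (Reg 6) (Reg 1), Move 9 (Const 2)]"

definition read_edge :: program where
  "read_edge = block [Load 11 (Reg 9), Add 9 (Reg 9) (Const 1), Load 12 (Reg 9), Add 9 (Reg 9) (Const 1),
     Add 10 (Reg 3) (Reg 11), Load 14 (Reg 10), Add 14 (Reg 14) (Const 1), Store (Reg 10) (Reg 14),
     Add 10 (Reg 3) (Reg 12), Load 14 (Reg 10), Add 14 (Reg 14) (Const 1), Store (Reg 10) (Reg 14),
     Add 10 (Reg 4) (Reg 11), Load 14 (Reg 10), Add 14 (Reg 14) (Reg 12), Store (Reg 10) (Reg 14),
     Add 10 (Reg 4) (Reg 12), Load 14 (Reg 10), Add 14 (Reg 14) (Reg 11), Store (Reg 10) (Reg 14),
     Add 8 (Reg 8) (Const 1)]"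

text \<open>Register 10 still holds the address of the leaf's degree, left there by
  \<open>scan_vertex\<close>; the first store clears that degree.\<close>

definition cut_leaf :: program where
  "cut_leaf = block [
     Store (Reg 10) (Const 0),
     Add 10 (Reg 4) (Reg 9), Load 13 (Reg 10), Store (Reg 10) (Const 0),
     Add 10 (Reg 3) (Reg 13), Load 14 (Reg 10), Sub 14 (Reg 14) (Const 1), Store (Reg 10) (Reg 14),
     Add 10 (Reg 4) (Reg 13), Load 14 (Reg 10), Sub 14 (Reg 14) (Reg 9), Store (Reg 10) (Reg 14)]"

text \<open>The truncated difference \<open>1 - x\<close> negates a bit, and \<open>1 - (1 - (x + y))\<close> is a disjunction.\<close>

definition update_states :: program where
  "update_states = block [
     Add 10 (Reg 5) (Reg 9), Load 15 (Reg 10),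
     Add 10 (Reg 6) (Reg 9), Load 16 (Reg 10),
     Add 10 (Reg 7) (Reg 9), Load 17 (Reg 10),
     Add 10 (Reg 6) (Reg 13), Load 18 (Reg 10),
     Add 14 (Reg 18) (Reg 15), Sub 14 (Const 1) (Reg 14), Sub 14 (Const 1) (Reg 14),
     Store (Reg 10) (Reg 14),
     Add 10 (Reg 7) (Reg 13), Load 14 (Reg 10), Sub 14 (Reg 14) (Reg 15),
     Add 16 (Reg 16) (Reg 18), Sub 16 (Const 1) (Reg 16),
     Add 14 (Reg 14) (Reg 16), Sub 14 (Const 1) (Reg 14), Sub 14 (Const 1) (Reg 14),
     Store (Reg 10) (Reg 14),
     Add 10 (Reg 5) (Reg 13), Load 14 (Reg 10), Sub 17 (Const 1) (Reg 17),
     Add 14 (Reg 14) (Reg 17), Sub 14 (Const 1) (Reg 14), Sub 14 (Const 1) (Reg 14),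
     Store (Reg 10) (Reg 14),
     Move 9 (Reg 13)]"

definition scan_vertex :: program where
  "scan_vertex = Seq (Add 10 (Reg 3) (Reg 9)) (Seq (Load 14 (Reg 10))
     (IfElse (Equal (Reg 14) (Const 1))
       (Seq cut_leaf update_states)
       (Seq (Add 8 (Reg 8) (Const 1)) (Move 9 (Reg 8)))))"

text \<open>Before it is added to 2, register 14 is 1 exactly if the root permits neither
  \<open>Out\<close> nor \<open>Matched\<close>. Trees with fewer than three vertices overwrite the
  result.\<close>

definition answer :: program where
  "answer = block [
     Add 10 (Reg 5) (Reg 13), Load 14 (Reg 10), Add 10 (Reg 7) (Reg 13), Load 15 (Reg 10),
     Sub 14 (Const 1) (Reg 14), Add 14 (Reg 14) (Reg 15),
     Sub 14 (Const 1) (Reg 14), Add 0 (Const 2) (Reg 14),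
     IfElse (Less (Reg 1) (Const 3)) (Sub 0 (Reg 1) (Const 1)) Skip]"

definition cf_index_program :: program where
  "cf_index_program = block [set_bases, While (Less (Reg 8) (Reg 2)) read_edge,
     Move 8 (Const 0), Move 9 (Const 0),
     While (Less (Reg 8) (Reg 1)) scan_vertex, answer]"

section \<open>Effect of the straight-line blocks on registers and arrays\<close>

definition bases_ok :: "nat \<Rightarrow> registers \<Rightarrow> bool" where
  "bases_ok n R \<longleftrightarrow> R 1 = n \<and> R 2 = n - 1 \<and> R 3 = 2 * n \<and> R 4 = 3 * n \<and> R 5 = 4 * n \<and>
     R 6 = 5 * n \<and> R 7 = 6 * n"

lemma wp_read_edge:
  assumes R: "bases_ok n R" "R 9 = a" "Suc a < 2 * n"
    and M: "M a = u" "M (Suc a) = v" "u < n" "v < n" "u \<noteq> v"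
    and W: "20 * n + 20 \<le> W" "M (2 * n + u) \<le> n" "M (2 * n + v) \<le> n"
      "M (3 * n + u) + v < W" "M (3 * n + v) + u < W" "R 8 < n"
  shows "wp W read_edge (\<lambda>t s. t \<le> 30 \<and> bases_ok n (fst s) \<and> fst s 13 = R 13 \<and>
      fst s 8 = Suc (R 8) \<and> fst s 9 = Suc (Suc a) \<and>
      (\<forall>x<n. snd s (2 * n + x) = M (2 * n + x) + (if x = u \<or> x = v then 1 else 0) \<and>
        snd s (3 * n + x) = M (3 * n + x) + (if x = u then v else if x = v then u else 0)) \<and>
      (\<forall>q. q < 2 * n \<or> 4 * n \<le> q \<longrightarrow> snd s q = M q)) (R, M)"
  using assms unfolding bases_ok_def
  by (simp add: read_edge_def wp_simps wp_Seq cong: wp_cong)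

lemma wp_cut_leaf:
  assumes R: "bases_ok n R" "R 9 = v" "R 10 = 2 * n + v"
    and M: "M (3 * n + v) = p" "p < n" "v < n" "v \<noteq> p"
    and W: "20 * n + 20 \<le> W" "M (2 * n + p) < W" "M (3 * n + p) < W"
  shows "wp W cut_leaf (\<lambda>t s. t \<le> 30 \<and> bases_ok n (fst s) \<and>
      fst s 13 = p \<and> fst s 8 = R 8 \<and> fst s 9 = v \<and>
      (\<forall>x<n. snd s (2 * n + x) =
          (if x = v then 0 else if x = p then M (2 * n + x) - 1 else M (2 * n + x)) \<and>
        snd s (3 * n + x) =
          (if x = v then 0 else if x = p then M (3 * n + x) - v else M (3 * n + x))) \<and>
      (\<forall>q\<ge>4 * n. snd s q = M q)) (R, M)"
  using assms unfolding bases_ok_def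
  by (simp add: cut_leaf_def wp_simps wp_Seq cong: wp_cong) linarith

definition bits_ok :: "nat \<Rightarrow> memory \<Rightarrow> bool" where
  "bits_ok n M \<longleftrightarrow> (\<forall>x<n. M (4 * n + x) \<le> 1 \<and> M (5 * n + x) \<le> 1 \<and> M (6 * n + x) \<le> 1)"

definition stored_states :: "nat \<Rightarrow> memory \<Rightarrow> nat \<Rightarrow> vstate \<Rightarrow> bool" where
  "stored_states n M x t = (case t of Out \<Rightarrow> M (4 * n + x) = 0 | Open \<Rightarrow> M (5 * n + x) = 0 |
     Matched \<Rightarrow> M (6 * n + x) = 1)"

text \<open>The three values are \<open>absorb\<close> in Boolean form, where inverted bits turn
  conjunctions into disjunctions. \<open>pm - vo\<close> means \<open>Matched\<close> at
  \<open>p\<close> with \<open>Out\<close> at \<open>v\<close>, and \<open>1 - (vn + pn)\<close>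
  means \<open>Open\<close> at both; here \<open>pn\<close> is the old bit, saved before it is
  overwritten.\<close>

lemma wp_update_states_arrays:
  assumes R: "bases_ok n R" "R 9 = v" "R 13 = p" "p < n" "v < n" "v \<noteq> p"
    and M: "M (4 * n + v) = vo" "M (5 * n + v) = vn" "M (6 * n + v) = vm"
      "M (4 * n + p) = po" "M (5 * n + p) = pn" "M (6 * n + p) = pm"
      "vo \<le> 1" "vn \<le> 1" "vm \<le> 1" "po \<le> 1" "pn \<le> 1" "pm \<le> 1"
    and W: "20 * n + 20 \<le> W"
  shows "wp W update_states (\<lambda>t s. t \<le> 40 \<and> bases_ok n (fst s) \<and>
      fst s 13 = p \<and> fst s 8 = R 8 \<and> fst s 9 = p \<and>
      snd s = M(5 * n + p := 1 - (1 - (pn + vo)),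
        6 * n + p := 1 - (1 - (pm - vo + (1 - (vn + pn)))),
        4 * n + p := 1 - (1 - (po + (1 - vm))))) (R, M)"
  using assms unfolding bases_ok_def
  by (simp add: update_states_def wp_simps wp_Seq cong: wp_cong) (intro conjI; linarith)

lemma wp_answer:
  assumes R: "bases_ok n R" "R 13 = r" "r < n"
    and M: "M (4 * n + r) = ro" "M (6 * n + r) = rm" "ro \<le> 1" "rm \<le> 1"
    and W: "20 * n + 20 \<le> W"
  shows "wp W answer (\<lambda>t s. t \<le> 40 \<and>
      fst s 0 = (if n < 3 then n - 1 else if ro = 0 \<or> rm = 1 then 2 else 3)) (R, M)"
  using assms unfolding bases_ok_def
  by (cases ro; cases rm) (simp_all add: answer_def wp_simps wp_Seq cong: wp_cong, linarith+)

lemma wp_update_states: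
  assumes R: "bases_ok n R" "R 9 = v" "R 13 = p" "p < n" "v < n" "v \<noteq> p"
    and M: "bits_ok n M" and W: "20 * n + 20 \<le> W"
  shows "wp W update_states (\<lambda>t s. t \<le> 40 \<and> bases_ok n (fst s) \<and>
      fst s 13 = p \<and> fst s 8 = R 8 \<and> fst s 9 = p \<and>
      (\<forall>q<4 * n. snd s q = M q) \<and> bits_ok n (snd s) \<and>
      (\<forall>x<n. stored_states n (snd s) x =
        (if x = p then absorb (stored_states n M p) (stored_states n M v) else stored_states n M x))) (R, M)"
proof -
  have bits: "M (4 * n + x) \<le> 1" "M (5 * n + x) \<le> 1" "M (6 * n + x) \<le> 1" if "x < n" for x
    using M that by (auto simp: bits_ok_def)
  let ?M = "M(5 * n + p := 1 - (1 - (M (5 * n + p) + M (4 * n + v))),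
        6 * n + p := 1 - (1 - (M (6 * n + p) - M (4 * n + v) + (1 - (M (5 * n + v) + M (5 * n + p))))),
        4 * n + p := 1 - (1 - (M (4 * n + p) + (1 - M (6 * n + v)))))"
  have "\<forall>q<4 * n. ?M q = M q"
    by auto
  moreover have "bits_ok n ?M"
    using bits by (auto simp: bits_ok_def)
  moreover have "stored_states n ?M x t =
        (if x = p then absorb (stored_states n M p) (stored_states n M v) else stored_states n M x) t"
    if "x < n" for x t
  proof (cases "x = p")
    case True
    then show ?thesis
      using bits[OF R(4)] bits[OF R(5)] R(4) by (cases t) (auto simp: stored_states_def)
  next
    case False
    then show ?thesis
      using R(4) that by (cases t) (auto simp: stored_states_def)
  qed
  then have "\<forall>x<n. stored_states n ?M x =
        (if x = p then absorb (stored_states n M p) (stored_states n M v) else stored_states n M x)"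
    by (intro allI impI ext)
  ultimately show ?thesis
    using wp_update_states_arrays[OF R refl refl refl refl refl refl
        bits[OF R(5)] bits[OF R(4)] W]
    by (elim wp_mono) simp
qed

section \<open>Degrees and neighbour sums under insertion and deletion of edges\<close>

definition represents :: "nat \<Rightarrow> nat set set \<Rightarrow> memory \<Rightarrow> bool" where
  "represents n E M \<longleftrightarrow>
     (\<forall>x<n. M (2 * n + x) = card (nbrs E x) \<and> M (3 * n + x) = \<Sum>(nbrs E x))"

lemma nbrs_insert:
  "nbrs (insert {u, v} E) x =
     nbrs E x \<union> (if x = u then {v} else {}) \<union> (if x = v then {u} else {})"
  by (auto simp: nbrs_def doubleton_eq_iff)

lemma nbrs_remove:
  "nbrs (E - {{u, v}}) x =
     nbrs E x - (if x = u then {v} else {}) - (if x = v then {u} else {})"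
  by (auto simp: nbrs_def doubleton_eq_iff)

lemma nbrs_sym: "x \<in> nbrs E y \<longleftrightarrow> y \<in> nbrs E x"
  by (simp add: nbrs_def insert_commute)

text \<open>The sums are the largest stored words; adding one more vertex number while reading
  explains the requirement \<open>n * n + n < W\<close>.\<close>

lemma represents_bounds:
  assumes "simple_graph V E" "V \<subseteq> {..<n}" "represents n E M" "x < n"
  shows "M (2 * n + x) \<le> n" "M (3 * n + x) \<le> n * n"
proof -
  have s: "nbrs E x \<subseteq> {..<n}"
    using nbrs_subset[OF assms(1)] assms(2) by blast
  then have c: "card (nbrs E x) \<le> n"
    using card_mono[of "{..<n}"] by fastforce
  have "\<Sum>(nbrs E x) \<le> of_nat (card (nbrs E x)) * n"
    using s by (intro sum_bounded_above) auto
  also have "\<dots> \<le> n * n"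
    using mult_le_mono1[OF c] by simp
  finally show "M (2 * n + x) \<le> n" "M (3 * n + x) \<le> n * n"
    using c assms(3,4) by (simp_all add: represents_def)
qed

lemma represents_insert:
  assumes sg: "simple_graph {..<n} (insert {u, v} E)" and new: "{u, v} \<notin> E"
    and M: "represents n E M"
    and M': "\<And>x. x < n \<Longrightarrow> M' (2 * n + x) = M (2 * n + x) + (if x = u \<or> x = v then 1 else 0)"
      "\<And>x. x < n \<Longrightarrow> M' (3 * n + x) = M (3 * n + x) + (if x = u then v else if x = v then u else 0)"
  shows "represents n (insert {u, v} E) M'"
proof -
  have uv: "u \<noteq> v"
    using simple_graph_edgeD[OF sg, of u v] by simp
  have "simple_graph {..<n} E"
    using sg by (simp add: simple_graph_def)
  then have fin: "finite (nbrs E x)" for x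
    using nbrs_subset finite_subset finite_lessThan by metis
  have "v \<notin> nbrs E u" "u \<notin> nbrs E v"
    using new by (simp_all add: nbrs_def insert_commute)
  then show ?thesis
    using M uv fin unfolding represents_def nbrs_insert by (auto simp: M')
qed

lemma represents_remove:
  assumes sg: "simple_graph V E" and v: "nbrs E v = {p}"
    and M: "represents n E M"
    and M': "\<And>x. x < n \<Longrightarrow> M' (2 * n + x) =
        (if x = v then 0 else if x = p then M (2 * n + x) - 1 else M (2 * n + x))"
      "\<And>x. x < n \<Longrightarrow> M' (3 * n + x) =
        (if x = v then 0 else if x = p then M (3 * n + x) - v else M (3 * n + x))"
  shows "represents n (E - {{v, p}}) M'"
proof -
  have fin: "finite (nbrs E x)" for x
    using nbrs_subset[OF sg] sg finite_subset by (metis simple_graph_def)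
  have vp: "v \<in> nbrs E p"
    using v nbrs_sym by fast
  have "v \<noteq> p"
    using simple_graph_edgeD[OF sg, of v p] v by (auto simp: nbrs_def)
  then show ?thesis
    using M fin vp v unfolding represents_def nbrs_remove
    by (auto simp: M' sum_diff1_nat)
qed

lemma solvable_cong:
  "(\<And>x. x \<in> V \<Longrightarrow> L x = L' x) \<Longrightarrow> solvable V E L = solvable V E L'"
  by (simp add: solvable_def solution_def)

lemma concat_pairs_nth:
  "i < length es \<Longrightarrow> concat (map (\<lambda>(u, v). [u, v]) es) ! (2 * i) = fst (es ! i) \<and>
     concat (map (\<lambda>(u, v). [u, v]) es) ! Suc (2 * i) = snd (es ! i)"
proof (induction es arbitrary: i)
  case (Cons e es)
  then show ?case
    by (cases i; cases e) auto
qed simp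

lemma length_concat_pairs: "length (concat (map (\<lambda>(u, v). [u, v]) es)) = 2 * length es"
  by (induction es) auto

lemma tree_lessThan_pos:
  fixes n :: nat
  assumes "is_tree {..<n} E"
  shows "n > 0"
  using is_treeD(3)[OF assms] by (metis gr0I lessThan_0)

section \<open>Loop invariants and total running time\<close>

context
  fixes n :: nat and E :: "nat set set" and es :: "(nat \<times> nat) list" and W :: nat
  assumes T: "is_tree {..<n} E" and es: "edge_list E es"
    and W: "20 * n + 20 \<le> W" "n * n + n < W"
begin

lemmas n_pos = tree_lessThan_pos[OF T]

lemma length_es: "length es = n - 1"
proof -
  have "length es = card (set (map (\<lambda>(u, v). {u, v}) es))"
    using es distinct_card[of "map (\<lambda>(u, v). {u, v}) es"] by (simp add: edge_list_def)
  also have "\<dots> = card E"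
    using es by (simp add: edge_list_def)
  finally show ?thesis
    using tree_card_edges[OF T] by simp
qed

definition read_edges_of :: "nat \<Rightarrow> nat set set" where
  "read_edges_of j = (\<lambda>(u, v). {u, v}) ` set (take j es)"

lemma read_edges_of_Suc:
  assumes "j < n - 1" "es ! j = (u, v)"
  shows "read_edges_of (Suc j) = insert {u, v} (read_edges_of j)" "{u, v} \<notin> read_edges_of j"
    "read_edges_of (Suc j) \<subseteq> E"
proof -
  have j: "j < length es"
    using assms length_es by simp
  then have t: "take (Suc j) es = take j es @ [(u, v)]"
    using assms(2) by (simp add: take_Suc_conv_app_nth)
  then show "read_edges_of (Suc j) = insert {u, v} (read_edges_of j)"
    by (simp add: read_edges_of_def)
  show "read_edges_of (Suc j) \<subseteq> E"
    using es by (auto simp: edge_list_def read_edges_of_def dest: in_set_takeD)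
  have "distinct (map (\<lambda>(u, v). {u, v}) (take (Suc j) es))"
    using es by (simp add: edge_list_def take_map[symmetric] del: take_Suc)
  then show "{u, v} \<notin> read_edges_of j"
    unfolding t by (simp add: read_edges_of_def)
qed

text \<open>The budget per edge is 30 for the body and 1 for the test. Register 13 stays 0 so that
  it names a vertex even if no leaf is ever cut, as for \<open>n = 1\<close>; the zero cells from
  \<open>4 * n\<close> on are the initial state sets.\<close>

definition read_inv :: "nat \<Rightarrow> machine_state \<Rightarrow> bool" where
  "read_inv k s \<longleftrightarrow> bases_ok n (fst s) \<and> fst s 13 = 0 \<and> fst s 8 \<le> n - 1 \<and>
     fst s 9 = 2 + 2 * fst s 8 \<and> represents n (read_edges_of (fst s 8)) (snd s) \<and>
     (\<forall>q<2 * n. snd s q = input_words n es ! q) \<and> (\<forall>q\<ge>4 * n. snd s q = 0) \<and>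
     k = 31 * (n - 1 - fst s 8)"

lemma read_step:
  assumes I: "read_inv k s" and b: "fst s 8 < fst s 2"
  shows "wp W read_edge (\<lambda>t s'. \<exists>k'. read_inv k' s' \<and> 1 + t + k' \<le> k) s"
proof -
  obtain R M where s: "s = (R, M)"
    by (cases s)
  define j where "j = R 8"
  note I' = I[unfolded read_inv_def s fst_conv snd_conv, folded j_def]
  have j: "j < n - 1"
    using b I' by (simp add: s j_def bases_ok_def)
  obtain u v where uv: "es ! j = (u, v)"
    by fastforce
  note next_edge = read_edges_of_Suc[OF j uv]
  have sg: "simple_graph {..<n} (insert {u, v} (read_edges_of j))"
    using is_treeD(1)[OF T] next_edge(1,3) by (auto simp: simple_graph_def)
  note uvn = simple_graph_edgeD[OF sg, of u v, simplified]
  have sg0: "simple_graph {..<n} (read_edges_of j)"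
    using sg by (simp add: simple_graph_def)
  have rep: "represents n (read_edges_of j) M"
    using I' by blast
  note bd = represents_bounds[OF sg0 subset_refl rep]
  have cell: "M (2 + 2 * j) = u" "M (Suc (2 + 2 * j)) = v"
    using I' j uv concat_pairs_nth[of j es] length_es by (auto simp: input_words_def)
  show ?thesis
    unfolding s
  proof (rule wp_mono[OF wp_read_edge[where n = n and R = R and a = "2 + 2 * j" and M = M and u = u and v = v and W = W]])
    show "bases_ok n R" "R 9 = 2 + 2 * j" "R 8 < n" "Suc (2 + 2 * j) < 2 * n"
      using I' j by (simp_all add: j_def)
    show "M (3 * n + u) + v < W" "M (3 * n + v) + u < W"
      using bd(2)[of u] bd(2)[of v] uvn W(2) by linarith+
    fix t :: nat and s' :: machine_state
    assume Q: "t \<le> 30 \<and> bases_ok n (fst s') \<and> fst s' 13 = R 13 \<and>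
      fst s' 8 = Suc (R 8) \<and> fst s' 9 = Suc (Suc (2 + 2 * j)) \<and>
      (\<forall>x<n. snd s' (2 * n + x) = M (2 * n + x) + (if x = u \<or> x = v then 1 else 0) \<and>
        snd s' (3 * n + x) = M (3 * n + x) + (if x = u then v else if x = v then u else 0)) \<and>
      (\<forall>q. q < 2 * n \<or> 4 * n \<le> q \<longrightarrow> snd s' q = M q)"
    have "represents n (read_edges_of (Suc j)) (snd s')"
      unfolding next_edge(1) by (rule represents_insert[OF sg next_edge(2) rep]) (use Q in blast)+
    moreover have "1 + t + 31 * (n - 1 - Suc j) \<le> k"
      using I' j Q by linarith
    ultimately have "read_inv (31 * (n - 1 - Suc j)) s'"
      using I' j Q by (simp add: read_inv_def j_def)
    then show "\<exists>k'. read_inv k' s' \<and> 1 + t + k' \<le> k"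
      using \<open>1 + t + 31 * (n - 1 - Suc j) \<le> k\<close> by blast
  qed (use cell uvn bd W in auto)
qed

text \<open>\<open>V\<close> and \<open>F\<close> form the remaining tree. Up to the counter, only
  the current vertex may be a leaf; when the scan ends this exception is \<open>n\<close>, which is
  no vertex. A cut costs at most 74 steps with its test, so 80 per unit of potential
  suffices.\<close>

definition scan_inv :: "nat \<Rightarrow> machine_state \<Rightarrow> bool" where
  "scan_inv k s \<longleftrightarrow> (\<exists>V F. bases_ok n (fst s) \<and> is_tree V F \<and> V \<subseteq> {..<n} \<and>
     represents n F (snd s) \<and> bits_ok n (snd s) \<and> fst s 13 \<in> V \<and>
     (solvable V F (stored_states n (snd s)) \<longleftrightarrow> solvable {..<n} E (\<lambda>_ t. t \<noteq> Matched)) \<and>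
     (fst s 8 < n \<and> fst s 9 < n \<or> fst s 8 = n \<and> fst s 9 = n) \<and>
     (\<forall>x<n. x \<le> fst s 8 \<longrightarrow> x \<noteq> fst s 9 \<longrightarrow> card (nbrs F x) \<noteq> 1) \<and>
     k = 80 * (card V + (n - fst s 8)))"

lemma scan_step:
  assumes I: "scan_inv k s" and b: "fst s 8 < fst s 1"
  shows "wp W scan_vertex (\<lambda>t s'. \<exists>k'. scan_inv k' s' \<and> 1 + t + k' \<le> k) s"
proof -
  obtain R M where s: "s = (R, M)"
    by (cases s)
  define i v where "i = R 8" and "v = R 9"
  obtain V F where I': "bases_ok n R" "is_tree V F" "V \<subseteq> {..<n}" "represents n F M" "bits_ok n M"
      "R 13 \<in> V" "solvable V F (stored_states n M) \<longleftrightarrow> solvable {..<n} E (\<lambda>_ t. t \<noteq> Matched)"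
      "i < n \<and> v < n \<or> i = n \<and> v = n"
      "\<And>x. x < n \<Longrightarrow> x \<le> i \<Longrightarrow> x \<noteq> v \<Longrightarrow> card (nbrs F x) \<noteq> 1"
      "k = 80 * (card V + (n - i))"
    using I unfolding scan_inv_def s fst_conv snd_conv i_def v_def by blast
  have i: "i < n" "v < n"
    using b I'(1,8) by (auto simp: s i_def bases_ok_def)
  note sg = is_treeD(1)[OF I'(2)]
  note bd = represents_bounds[OF sg I'(3,4)]
  have Mv: "M (2 * n + v) = card (nbrs F v)" "M (3 * n + v) = \<Sum>(nbrs F v)"
    using I'(4) i by (simp_all add: represents_def)
  let ?R = "R(10 := 2 * n + v, 14 := card (nbrs F v))"
  have R: "bases_ok n ?R" "?R 9 = v" "?R 8 = i" "?R 10 = 2 * n + v" "?R 13 = R 13"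
    using I'(1) by (simp_all add: bases_ok_def i_def v_def)
  \<comment> \<open>The common prefix is evaluated once for any postcondition; the three units are
    the addition, the load and the branch.\<close>
  have start: "wp W scan_vertex Q s \<longleftrightarrow>
      (if card (nbrs F v) = 1 then wp W (Seq cut_leaf update_states) (\<lambda>t. Q (1 + (1 + (1 + t)))) (?R, M)
       else wp W (Seq (Add 8 (Reg 8) (Const 1)) (Move 9 (Reg 8))) (\<lambda>t. Q (1 + (1 + (1 + t)))) (?R, M))" for Q
    using I'(1) i Mv(1) W(1) bd(1)[OF i(2)] v_def
    by (simp add: scan_vertex_def s wp_simps wp_Seq bases_ok_def cong: wp_cong) simp
  show ?thesis
  proof (cases "card (nbrs F v) = 1")
    case False
    let ?s' = "(?R(8 := Suc i, 9 := Suc i), M)"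
    have "scan_inv (80 * (card V + (n - Suc i))) ?s'"
      unfolding scan_inv_def
      using R(1) I' i False
      by (intro exI[of _ V] exI[of _ F]) (auto simp: bases_ok_def le_Suc_eq)
    moreover have "1 + 8 + 80 * (card V + (n - Suc i)) \<le> k"
      using I'(10) i by simp
    ultimately show ?thesis
      using False i W(1) R unfolding start
      by (simp add: wp_simps wp_Seq cong: wp_cong) (rule exI[of _ "80 * (card V + (n - Suc i))"], simp)
  next
    case True
    then obtain p where p: "nbrs F v = {p}"
      by (auto simp: card_1_singleton_iff)
    then have vV: "v \<in> V"
      using simple_graph_edgeD[OF sg, of v p] by (auto simp: nbrs_def)
    note rl = tree_remove_leaf[OF I'(2) vV p]
    have pn: "p < n" "v \<noteq> p"
      using rl(2) I'(3) by auto
    let ?F = "F - {{v, p}}"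
    have cut: "wp W cut_leaf (\<lambda>t s. t \<le> 30 \<and> bases_ok n (fst s) \<and>
      fst s 13 = p \<and> fst s 8 = i \<and> fst s 9 = v \<and>
      (\<forall>x<n. snd s (2 * n + x) =
          (if x = v then 0 else if x = p then M (2 * n + x) - 1 else M (2 * n + x)) \<and>
        snd s (3 * n + x) =
          (if x = v then 0 else if x = p then M (3 * n + x) - v else M (3 * n + x))) \<and>
      (\<forall>q\<ge>4 * n. snd s q = M q)) (?R, M)"
    proof -
      have "M (3 * n + v) = p" "M (2 * n + p) < W" "M (3 * n + p) < W"
        using Mv(2) p W bd[OF pn(1)] by simp_all
      from wp_cut_leaf[OF R(1,2,4) this(1) pn(1) i(2) pn(2) W(1) this(2,3)]
      show ?thesis
        unfolding R(3) .
    qed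
    have "wp W (Seq cut_leaf update_states) (\<lambda>t s'. \<exists>k'. scan_inv k' s' \<and> 1 + (1 + (1 + (1 + t))) + k' \<le> k) (?R, M)"
      unfolding wp_Seq
    proof (rule wp_mono[OF cut])
      fix t :: nat and s1 :: machine_state
      assume Q1: "t \<le> 30 \<and> bases_ok n (fst s1) \<and> fst s1 13 = p \<and> fst s1 8 = i \<and> fst s1 9 = v \<and>
        (\<forall>x<n. snd s1 (2 * n + x) =
            (if x = v then 0 else if x = p then M (2 * n + x) - 1 else M (2 * n + x)) \<and>
          snd s1 (3 * n + x) =
            (if x = v then 0 else if x = p then M (3 * n + x) - v else M (3 * n + x))) \<and>
        (\<forall>q\<ge>4 * n. snd s1 q = M q)"
      obtain R1 M1 where s1: "s1 = (R1, M1)"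
        by (cases s1)
      have rep1: "represents n ?F M1"
        by (rule represents_remove[OF sg p I'(4)]) (use Q1 s1 in auto)
      have bits1: "bits_ok n M1"
        using I'(5) Q1 s1 by (simp add: bits_ok_def)
      have st1: "stored_states n M1 x = stored_states n M x" for x
        using Q1 s1 by (intro ext) (simp add: stored_states_def split: vstate.split)
      have R1: "bases_ok n R1" "R1 9 = v" "R1 13 = p" "R1 8 = i"
        using Q1 s1 by auto
      show "wp W update_states (\<lambda>u s'. \<exists>k'. scan_inv k' s' \<and> 1 + (1 + (1 + (1 + (t + u)))) + k' \<le> k) s1"
        unfolding s1
      proof (rule wp_mono[OF wp_update_states[OF R1(1-3) pn(1) i(2) pn(2) bits1 W(1)]])
        fix u :: nat and s2 :: machine_state
        assume Q2: "u \<le> 40 \<and> bases_ok n (fst s2) \<and> fst s2 13 = p \<and> fst s2 8 = R1 8 \<and> fst s2 9 = p \<and>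
          (\<forall>q<4 * n. snd s2 q = M1 q) \<and> bits_ok n (snd s2) \<and>
          (\<forall>x<n. stored_states n (snd s2) x =
            (if x = p then absorb (stored_states n M1 p) (stored_states n M1 v)
             else stored_states n M1 x))"
        have rep2: "represents n ?F (snd s2)"
          using rep1 Q2 by (simp add: represents_def)
        have "solvable V F (stored_states n M) \<longleftrightarrow> solvable (V - {v}) ?F (stored_states n (snd s2))"
          by (rule solvable_remove_leaf[OF sg vV p]) (use Q2 st1 I'(3) pn in auto)
        \<comment> \<open>Only two degrees change: that of \<open>v\<close> becomes 0, and
          \<open>p\<close> is the new exception.\<close>
        moreover have "card (nbrs ?F x) \<noteq> 1" if "x < n" "x \<le> i" "x \<noteq> p" for x
          using I'(9)[OF that(1,2)] that(3) p unfolding nbrs_remove by auto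
        ultimately have "scan_inv (80 * (card (V - {v}) + (n - i))) s2"
          unfolding scan_inv_def
          using Q2 rl(1,2) I'(3,7) rep2 pn i R1
          by (intro exI[of _ "V - {v}"] exI[of _ ?F]) auto
        moreover have "1 + (1 + (1 + (1 + (t + u)))) + 80 * (card (V - {v}) + (n - i)) \<le> k"
        proof -
          have "Suc (card (V - {v})) = card V"
            using card_Suc_Diff1[OF is_treeD(2)[OF I'(2)] vV] .
          then show ?thesis
            using I'(10) Q1[THEN conjunct1] Q2[THEN conjunct1] by simp
        qed
        ultimately show "\<exists>k'. scan_inv k' s2 \<and> 1 + (1 + (1 + (1 + (t + u)))) + k' \<le> k"
          by blast
      qed
    qed
    then show ?thesis
      using True unfolding start by simp
  qed
qed

text \<open>The bounds of the parts add up to \<open>191 * n + 34\<close>, which is below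
  \<open>300 * n\<close> as a tree has a vertex.\<close>

lemma wp_cf_index_program:
  assumes deg: "\<forall>v\<in>{..<n}. vertex_degree E v \<noteq> 2"
  shows "wp W cf_index_program (\<lambda>t s. t \<le> 300 * n \<and> fst s 0 = cf_chromatic_index E)
    (initial_state (input_words n es))"
proof -
  have len: "length (input_words n es) = 2 * n"
    using n_pos length_es length_concat_pairs[of es] by (simp add: input_words_def)
  define M0 where "M0 = (\<lambda>p. if p < length (input_words n es) then input_words n es ! p else 0)"
  have init: "initial_state (input_words n es) = ((\<lambda>_. 0), M0)"
    by (simp add: initial_state_def M0_def)
  have M0: "M0 0 = n" "M0 1 = n - 1" "M0 (Suc 0) = n - 1"
    using n_pos len length_es by (simp_all add: M0_def) (simp_all add: input_words_def)
  have rep0: "represents n (read_edges_of 0) M0"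
    using len by (auto simp: represents_def M0_def read_edges_of_def nbrs_def)
  have 1: "wp W set_bases (\<lambda>t s. t \<le> 20 \<and> read_inv (31 * (n - 1)) s)
      (initial_state (input_words n es))"
    using M0 W(1) rep0 len unfolding init
    by (simp add: set_bases_def wp_simps wp_Seq read_inv_def bases_ok_def cong: wp_cong)
      (simp add: M0_def)
  have 2: "wp W (While (Less (Reg 8) (Reg 2)) read_edge) (\<lambda>t s. t \<le> 31 * (n - 1) + 1 \<and>
      bases_ok n (fst s) \<and> fst s 13 = 0 \<and> represents n E (snd s) \<and> (\<forall>q\<ge>4 * n. snd s q = 0)) s"
    if "read_inv (31 * (n - 1)) s" for s
  proof (rule wp_mono[OF wp_While[where I = read_inv, OF _ that]])
    show "wp W read_edge (\<lambda>t s'. \<exists>k'. read_inv k' s' \<and> 1 + t + k' \<le> k) s"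
      if "read_inv k s" "test_val (fst s) (Less (Reg 8) (Reg 2))" for k s
      using read_step that by simp
    fix t :: nat and s' :: machine_state
    assume Q: "t \<le> 31 * (n - 1) + 1 \<and>
      (\<exists>k'. read_inv k' s' \<and> \<not> test_val (fst s') (Less (Reg 8) (Reg 2)))"
    then have "fst s' 8 = n - 1"
      by (auto simp: read_inv_def bases_ok_def)
    moreover have "read_edges_of (n - 1) = E"
      using es length_es by (simp add: read_edges_of_def edge_list_def)
    ultimately show "t \<le> 31 * (n - 1) + 1 \<and> bases_ok n (fst s') \<and> fst s' 13 = 0 \<and>
        represents n E (snd s') \<and> (\<forall>q\<ge>4 * n. snd s' q = 0)"
      using Q by (auto simp: read_inv_def)
  qed
  have 3: "scan_inv (80 * (n + n)) (R(8 := 0, 9 := 0), M)"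
    if "bases_ok n R" "R 13 = 0" "represents n E M" "\<forall>q\<ge>4 * n. M q = 0" for R M
  proof -
    have "solvable {..<n} E (stored_states n M) = solvable {..<n} E (\<lambda>_ t. t \<noteq> Matched)"
      using that(4) by (intro solvable_cong ext) (simp add: stored_states_def split: vstate.split)
    then show ?thesis
      unfolding scan_inv_def using that T n_pos
      by (intro exI[of _ "{..<n}"] exI[of _ E]) (auto simp: bases_ok_def bits_ok_def)
  qed
  have 4: "wp W (While (Less (Reg 8) (Reg 1)) scan_vertex)
      (\<lambda>t s. t \<le> 80 * (n + n) + 1 \<and> (\<exists>k. scan_inv k s \<and> fst s 8 = n)) s"
    if "scan_inv (80 * (n + n)) s" for s
  proof (rule wp_mono[OF wp_While[where I = scan_inv, OF _ that]])
    show "wp W scan_vertex (\<lambda>t s'. \<exists>k'. scan_inv k' s' \<and> 1 + t + k' \<le> k) s"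
      if "scan_inv k s" "test_val (fst s) (Less (Reg 8) (Reg 1))" for k s
      using scan_step that by simp
    fix t :: nat and s' :: machine_state
    assume Q: "t \<le> 80 * (n + n) + 1 \<and>
      (\<exists>k'. scan_inv k' s' \<and> \<not> test_val (fst s') (Less (Reg 8) (Reg 1)))"
    then have "fst s' 8 = n"
      unfolding scan_inv_def bases_ok_def by auto
    then show "t \<le> 80 * (n + n) + 1 \<and> (\<exists>k. scan_inv k s' \<and> fst s' 8 = n)"
      using Q by blast
  qed
  have 5: "wp W answer (\<lambda>t s. t \<le> 40 \<and> fst s 0 = cf_chromatic_index E) s"
    if I: "scan_inv k s" and at_end: "fst s 8 = n" for k s
  proof -
    obtain R M where s: "s = (R, M)"
      by (cases s)
    obtain V F where I': "bases_ok n R" "is_tree V F" "V \<subseteq> {..<n}" "bits_ok n M"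
      "R 13 \<in> V" "solvable V F (stored_states n M) \<longleftrightarrow> solvable {..<n} E (\<lambda>_ t. t \<noteq> Matched)"
      "\<And>x. x < n \<Longrightarrow> card (nbrs F x) \<noteq> 1"
      using I at_end unfolding scan_inv_def s fst_conv snd_conv
      by (metis less_imp_le_nat nat_neq_iff)
    \<comment> \<open>No vertex is exempt any more, so the remaining tree has no leaf and thus a
      single vertex, held in register 13.\<close>
    have "\<not> card V \<ge> 2"
      using tree_has_leaf[OF I'(2)] I'(3,7) by (force simp: card_1_singleton_iff)
    then have V: "V = {R 13}"
      using I'(5) is_treeD(2)[OF I'(2)] card_le_Suc0_iff_eq[of V] by auto
    then have "F = {}"
      using tree_singleton I'(2) by metis
    then have iff: "solvable {..<n} E (\<lambda>_ t. t \<noteq> Matched) \<longleftrightarrow> M (4 * n + R 13) = 0 \<or> M (6 * n + R 13) = 1"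
      using I'(6) V by (simp add: solvable_singleton stored_states_def)
    have r: "R 13 < n"
      using I'(3,5) by auto
    then have "M (4 * n + R 13) \<le> 1" "M (6 * n + R 13) \<le> 1"
      using I'(4) by (auto simp: bits_ok_def)
    note bits = this
    have "cf_chromatic_index E = (if n < 3 then n - 1
        else if M (4 * n + R 13) = 0 \<or> M (6 * n + R 13) = 1 then 2 else 3)"
      unfolding cf_chromatic_index_tree[OF T deg] iff by simp
    then show ?thesis
      unfolding s by (simp only:) (rule wp_answer[OF I'(1) refl r refl refl bits W(1)])
  qed
  show ?thesis
    unfolding cf_index_program_def block.simps wp_Seq
  proof (rule wp_mono[OF 1])
    fix t1 :: nat and s1 :: machine_state assume Q1: "t1 \<le> 20 \<and> read_inv (31 * (n - 1)) s1"
    show "wp W (While (Less (Reg 8) (Reg 2)) read_edge) (\<lambda>t2.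
        wp W (Move 8 (Const 0)) (\<lambda>t3. wp W (Move 9 (Const 0)) (\<lambda>t4.
        wp W (While (Less (Reg 8) (Reg 1)) scan_vertex) (\<lambda>t5. wp W answer (\<lambda>t6. wp W Skip (\<lambda>t7 s.
          t1 + (t2 + (t3 + (t4 + (t5 + (t6 + t7))))) \<le> 300 * n \<and> fst s 0 = cf_chromatic_index E)))))) s1"
    proof (rule wp_mono[OF 2])
      show "read_inv (31 * (n - 1)) s1"
        using Q1 by blast
      fix t2 :: nat and s2 :: machine_state assume Q2: "t2 \<le> 31 * (n - 1) + 1 \<and> bases_ok n (fst s2) \<and> fst s2 13 = 0 \<and>
        represents n E (snd s2) \<and> (\<forall>q\<ge>4 * n. snd s2 q = 0)"
      obtain R M where s2: "s2 = (R, M)"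
        by (cases s2)
      have "wp W (While (Less (Reg 8) (Reg 1)) scan_vertex) (\<lambda>t5. wp W answer (\<lambda>t6. wp W Skip (\<lambda>t7 s.
          t1 + (t2 + (1 + (1 + (t5 + (t6 + t7))))) \<le> 300 * n \<and> fst s 0 = cf_chromatic_index E)))
          (R(8 := 0, 9 := 0), M)"
      proof (rule wp_mono[OF 4[OF 3]])
        fix t5 :: nat and s5 :: machine_state
        assume Q5: "t5 \<le> 80 * (n + n) + 1 \<and> (\<exists>k. scan_inv k s5 \<and> fst s5 8 = n)"
        then obtain k where k: "scan_inv k s5" "fst s5 8 = n"
          by blast
        show "wp W answer (\<lambda>t6. wp W Skip (\<lambda>t7 s.
          t1 + (t2 + (1 + (1 + (t5 + (t6 + t7))))) \<le> 300 * n \<and> fst s 0 = cf_chromatic_index E)) s5"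
        proof (rule wp_mono[OF 5[OF k]])
          fix t6 :: nat and s6 :: machine_state
          assume Q6: "t6 \<le> 40 \<and> fst s6 0 = cf_chromatic_index E"
          show "wp W Skip (\<lambda>t7 s. t1 + (t2 + (1 + (1 + (t5 + (t6 + t7))))) \<le> 300 * n \<and>
              fst s 0 = cf_chromatic_index E) s6"
            unfolding wp_simps using Q6[THEN conjunct1] Q6[THEN conjunct2] Q1[THEN conjunct1] Q2[THEN conjunct1] Q5[THEN conjunct1] n_pos
            by (intro conjI; cases n; simp)
        qed
      qed (use Q2 s2 in auto)
      then show "wp W (Move 8 (Const 0)) (\<lambda>t3. wp W (Move 9 (Const 0)) (\<lambda>t4.
        wp W (While (Less (Reg 8) (Reg 1)) scan_vertex) (\<lambda>t5. wp W answer (\<lambda>t6. wp W Skip (\<lambda>t7 s.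
          t1 + (t2 + (t3 + (t4 + (t5 + (t6 + t7))))) \<le> 300 * n \<and> fst s 0 = cf_chromatic_index E))))) s2"
        using W(1) unfolding s2 by (simp add: wp_simps)
    qed
  qed
qed

end

theorem theorem4:
  shows "\<exists>(P :: program) (d :: nat) (T :: nat \<Rightarrow> nat).
           (\<lambda>n. real (T n)) \<in> O(\<lambda>n. real n) \<and>
           (\<forall>(n :: nat) (E :: nat set set) (es :: (nat \<times> nat) list).
              is_tree {..<n} E \<longrightarrow> (\<forall>v\<in>{..<n}. vertex_degree E v \<noteq> 2) \<longrightarrow> edge_list E es \<longrightarrow>
              outputs_within ((n + 1) ^ d) P (input_words n es) (T n) (cf_chromatic_index E))"
proof (intro exI[of _ cf_index_program] exI[of _ 10] exI[of _ "\<lambda>n. 300 * n"] conjI allI impI)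
  show "(\<lambda>n. real (300 * n)) \<in> O(\<lambda>n. real n)"
    by simp
  fix n :: nat and E :: "nat set set" and es :: "(nat \<times> nat) list"
  assume T: "is_tree {..<n} E" and deg: "\<forall>v\<in>{..<n}. vertex_degree E v \<noteq> 2" and es: "edge_list E es"
  have pow: "N ^ 9 * N = N ^ 10" for N :: nat
    by (simp add: eval_nat_numeral)
  \<comment> \<open>As \<open>n > 0\<close>, nine of the ten factors \<open>n + 1\<close> contribute
    at least \<open>2 ^ 9\<close>, more than the 20 required.\<close>
  have "20 * n + 20 \<le> 2 ^ 9 * (n + 1)"
    by simp
  also have "\<dots> \<le> (n + 1) ^ 9 * (n + 1)"
    using tree_lessThan_pos[OF T] by (intro mult_le_mono1 power_mono) auto
  also have "\<dots> = (n + 1) ^ 10"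
    by (rule pow)
  finally have W1: "20 * n + 20 \<le> (n + 1) ^ 10" .
  have "n * n + n < (n + 1) ^ 2"
    by (simp add: power2_eq_square)
  also have "\<dots> \<le> (n + 1) ^ 10"
    by (intro power_increasing) auto
  finally have W2: "n * n + n < (n + 1) ^ 10" .
  show "outputs_within ((n + 1) ^ 10) cf_index_program (input_words n es) (300 * n) (cf_chromatic_index E)"
    using wp_cf_index_program[OF T es W1 W2 deg] unfolding wp_def outputs_within_def by blast
qed

end
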